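(* Let $F_n$ denote the number of pairwise non-isomorphic fringe subtrees of a uniformly random ordered binary tree with $n$ leaves. There are two constants $c_1 \approx 1.0591261434$ and $c_2 \approx 1.0761505454$ such that, as $n\to\infty$: (i) $\displaystyle c_1 \frac{n}{\sqrt{\ln n}}(1+o(1)) \le \mathbb{E}(F_n) \le c_2 \frac{n}{\sqrt{\ln n}}(1+o(1))$; (ii) with high probability, $\displaystyle c_1 \frac{n}{\sqrt{\ln n}}(1+o(1)) \le F_n \le c_2 \frac{n}{\sqrt{\ln n}}(1+o(1))$, i.e. for every fixed $\eta>0$, $\mathbb{P}\big((c_1-\eta)\frac{n}{\sqrt{\ln n}} \le F_n \le (c_2+\eta)\frac{n}{\sqrt{\ln n}}\big)\to 1$.
   Context: A binary tree is a rooted tree in which every node has either exactly two children or none; it is ordered if the children of each inner node are ordered (left/right). The size of a binary tree is its number of leaves. A uniformly random ordered binary tree with $n$ leaves is chosen uniformly among all $C_{n-1}=\frac1n\binom{2n-2}{n-1}$ ordered binary trees with $n$ leaves. A fringe subtree of a tree $t$ is the subtree consisting of a node $v$ of $t$ together with all its descendants. Two ordered binary trees are isomorphic if they are equal as unordered rooted trees (i.e. one can be obtained from the other by swapping children of some inner nodes). "With high probability" means with probability tending to $1$ as $n\to\infty$. *)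

theory Defs
  imports "HOL-Probability.Probability" "HOL-Library.Tree"
begin

text \<open>
  An ordered binary tree in which every node has exactly two children or none is a
  \<^typ>\<open>unit tree\<close>: the constructor \<^const>\<open>Leaf\<close> is a leaf, \<^const>\<open>Node\<close> an inner node.
  The size of such a tree in the sense of its number of leaves is therefore
  \<^const>\<open>size1\<close> (not \<^const>\<open>size\<close>, which counts inner nodes), and
  \<^term>\<open>subtrees t\<close> is the set of the fringe subtrees of \<^term>\<open>t\<close>, single leaves and
  \<^term>\<open>t\<close> itself included.
\<close>

definition trees_with_leaves :: "nat \<Rightarrow> unit tree set" where
  "trees_with_leaves n = {t. size1 t = n}"

lemma trees_with_leaves_nonempty:
  assumes "n \<ge> 1"
  shows "trees_with_leaves n \<noteq> {}"
proof -
  have "\<exists>t :: unit tree. size1 t = Suc m" for m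
  proof (induction m)
    case 0
    show ?case by (intro exI[of _ Leaf]) simp
  next
    case (Suc m)
    then obtain t :: "unit tree" where "size1 t = Suc m" by blast
    then show ?case by (intro exI[of _ "Node Leaf () t"]) simp
  qed
  from this[of "n - 1"] assms show ?thesis by (auto simp: trees_with_leaves_def)
qed

lemma finite_trees_with_leaves: "finite (trees_with_leaves n)"
proof -
  have "finite {t :: unit tree. size t \<le> m}" for m
  proof (induction m)
    case 0
    show ?case by simp
  next
    case (Suc m)
    let ?S = "{t :: unit tree. size t \<le> m}"
    have "t \<in> insert Leaf ((\<lambda>(l, r). Node l () r) ` (?S \<times> ?S))"
      if "size t \<le> Suc m" for t :: "unit tree"
      using that by (cases t) auto
    then have "{t :: unit tree. size t \<le> Suc m}
        \<subseteq> insert Leaf ((\<lambda>(l, r). Node l () r) ` (?S \<times> ?S))"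
      by blast
    with Suc.IH show ?case by (meson finite_SigmaI finite_imageI finite_insert finite_subset)
  qed
  then show ?thesis
    by (rule finite_subset[of _ "{t. size t \<le> n}", rotated])
      (auto simp: trees_with_leaves_def size1_size)
qed

text \<open>The uniform distribution on the ordered binary trees with \<open>n\<close> leaves; meaningful for
  \<open>n \<ge> 1\<close>, where the set is nonempty.\<close>

definition random_tree :: "nat \<Rightarrow> unit tree pmf" where
  "random_tree n = pmf_of_set (trees_with_leaves n)"

text \<open>Equality as unordered rooted trees: at every inner node the two children may be swapped
  or not.\<close>

inductive tree_iso :: "unit tree \<Rightarrow> unit tree \<Rightarrow> bool" where
  leaf: "tree_iso Leaf Leaf"
| keep: "tree_iso l l' \<Longrightarrow> tree_iso r r' \<Longrightarrow> tree_iso (Node l u r) (Node l' u' r')"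
| swap: "tree_iso l l' \<Longrightarrow> tree_iso r r' \<Longrightarrow> tree_iso (Node l u r) (Node r' u' l')"

lemma tree_iso_refl: "tree_iso t t"
  by (induction t) (auto intro: tree_iso.intros)

lemma tree_iso_sym: "tree_iso s t \<Longrightarrow> tree_iso t s"
  by (induction rule: tree_iso.induct) (auto intro: tree_iso.intros)

lemma tree_iso_trans: "tree_iso s t \<Longrightarrow> tree_iso t v \<Longrightarrow> tree_iso s v"
proof (induction arbitrary: v rule: tree_iso.induct)
  case leaf
  then show ?case .
next
  case (keep l l' r r' u u')
  from keep.prems show ?case
    by cases (auto intro: tree_iso.intros keep.IH)
next
  case (swap l l' r r' u u')
  from swap.prems show ?case
    by cases (auto intro: tree_iso.intros swap.IH)
qed

definition tree_iso_rel :: "unit tree rel" where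
  "tree_iso_rel = {(s, t). tree_iso s t}"

lemma equiv_tree_iso_rel: "equiv UNIV tree_iso_rel"
  by (auto simp: tree_iso_rel_def intro!: equivI refl_onI symI transI
      intro: tree_iso_refl tree_iso_sym tree_iso_trans)

text \<open>The number of pairwise non-isomorphic fringe subtrees: the number of isomorphism classes
  with a representative among the fringe subtrees.\<close>

definition num_fringe_classes :: "unit tree \<Rightarrow> nat" where
  "num_fringe_classes t = card (subtrees t // tree_iso_rel)"

end

theory Submission
  imports Defs "HOL-Computational_Algebra.Formal_Power_Series" "HOL-Real_Asymp.Real_Asymp"
begin

text \<open>
  For a set \<open>A\<close> of trees with generating function \<open>a\<close>, the generating functions of the first two
  moments of the number of fringe subtrees in \<open>A\<close> are obtained from \<open>a\<close> by multiplication with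
  powers of \<open>(1 - 4x)\<^sup>-\<^sup>1\<^sup>/\<^sup>2\<close>. Monotonicity of the coefficients then gives, without any asymptotic
  analysis, a variance of order \<open>n\<close> times the largest size in \<open>A\<close>, and an expected number of fringe
  subtrees with at least \<open>k\<close> leaves of about \<open>2n / sqrt (\<pi> k)\<close>.

  Upper bound: fringe subtrees with fewer than \<open>k\<close> leaves lie in at most \<open>\<rho>\<^sup>-\<^sup>k\<close> classes, where \<open>1/\<rho>\<close>
  is the growth constant of unordered binary trees; choose \<open>k\<close> with \<open>\<rho>\<^sup>-\<^sup>k\<close> about \<open>n / ln n\<close> and
  count all larger fringe subtrees as distinct.

  Lower bound: a tree with \<open>k\<close> leaves and \<open>s\<close> nodes with isomorphic children has a class of size
  \<open>2\<^sup>k\<^sup>-\<^sup>1\<^sup>-\<^sup>s\<close>, and \<open>s\<close> exceeds \<open>\<nu> k\<close> for almost all trees. Beyond the threshold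
  \<open>2 powr ((1 + \<nu>) k) = n ln n\<close>, isomorphic pairs of such typical fringe subtrees are negligible.

  Both constants have a little room within the required precision, so that rational bounds for \<open>\<rho>\<close>
  and \<open>\<nu>\<close> suffice and the error terms can be taken to be zero.
\<close>

unbundle no vec_syntax
unbundle fps_syntax

subsection \<open>Central binomial coefficients\<close>

definition central :: "nat \<Rightarrow> real" where
  "central m = real ((2 * m) choose m)"

lemma central_0 [simp]: "central 0 = 1"
  by (simp add: central_def)

lemma central_pos [simp]: "central m > 0"
  by (simp add: central_def)

lemma central_Suc: "real (Suc m) * central (Suc m) = 2 * (2 * real m + 1) * central m"
proof -
  have 1: "Suc (2*m+1) * ((2*m+1) choose m) = (Suc (2*m+1) choose Suc m) * Suc m"
    by (rule Suc_times_binomial_eq)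
  have 2: "((2*m+1) choose m) = ((2*m+1) choose Suc m)"
    using binomial_symmetric[of m "2*m+1"] by simp
  have 3: "Suc (2*m) * ((2*m) choose m) = (Suc (2*m) choose Suc m) * Suc m"
    by (rule Suc_times_binomial_eq)
  define a b c where "a = (2 * Suc m choose Suc m)" and "b = ((2*m+1) choose m)"
    and "c = ((2*m) choose m)"
  have "a * Suc m = (2 * b) * Suc m"
    using 1 by (simp add: a_def b_def algebra_simps del: binomial_Suc_Suc)
  hence "a = 2 * b"
    by (subst (asm) mult_cancel2) simp
  moreover have "(2*m+1) * c = b * Suc m"
    using 2 3 by (simp add: b_def c_def del: binomial_Suc_Suc)
  ultimately have "Suc m * a = 2 * (2*m+1) * c"
    by (simp add: algebra_simps)
  hence "Suc m * ((2 * Suc m) choose Suc m) = 2 * (2*m+1) * ((2*m) choose m)"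
    by (simp only: a_def c_def)
  hence "real (Suc m * ((2 * Suc m) choose Suc m)) = real (2 * (2*m+1) * ((2*m) choose m))"
    by (rule arg_cong)
  thus ?thesis unfolding central_def by (simp only: of_nat_mult of_nat_add of_nat_numeral of_nat_1)
qed

text \<open>The coefficient of x^m in (1 - x)^(-1/2): the exponential growth 4^m is removed, so that
  terms belonging to different sizes can be compared directly.\<close>

definition central_ratio :: "nat \<Rightarrow> real" where
  "central_ratio m = central m / 4 ^ m"

lemma central_ratio_pos [simp]: "central_ratio m > 0"
  by (simp add: central_ratio_def)

lemma central_ratio_0 [simp]: "central_ratio 0 = 1"
  by (simp add: central_ratio_def)

lemma central_eq: "central m = 4 ^ m * central_ratio m"
  by (simp add: central_ratio_def)

lemma central_ratio_Suc:
  "central_ratio (Suc m) = (2 * real m + 1) / (2 * real m + 2) * central_ratio m"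
proof -
  have "(2 * real m + 2) * central (Suc m) = 4 * (2 * real m + 1) * central m"
    using central_Suc[of m] by (simp add: algebra_simps)
  hence "central (Suc m) = 4 * ((2 * real m + 1) / (2 * real m + 2) * central m)"
    by (simp add: divide_simps mult_ac)
  thus ?thesis by (simp add: central_ratio_def)
qed

text \<open>Up to the factor 4^m the left side is the Catalan number of trees with
  \<open>Suc m\<close> leaves. This gives the density of all small fringe subtrees in closed
  form.\<close>

lemma central_ratio_telescope:
  "central_ratio m / real (Suc m) = 2 * (central_ratio m - central_ratio (Suc m))"
  unfolding central_ratio_Suc by (simp add: field_simps)

lemma central_ratio_antimono: "m \<le> n \<Longrightarrow> central_ratio n \<le> central_ratio m"
proof (induction n rule: dec_induct)
  case (step n)
  have "central_ratio (Suc n) \<le> 1 * central_ratio n"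
    unfolding central_ratio_Suc by (intro mult_right_mono) (auto simp: less_imp_le)
  with step show ?case by simp
qed simp

text \<open>The terms are the coefficients of (1 - x)^(-3/2). Together with
  \<open>central_ratio_antimono\<close> this controls the moments: the decreasing sequence bounds
  means from below, the increasing one bounds means and second moments from above.\<close>

lemma central_ratio_weighted_mono:
  "m \<le> n \<Longrightarrow> (2 * real m + 1) * central_ratio m \<le> (2 * real n + 1) * central_ratio n"
proof (induction n rule: dec_induct)
  case (step n)
  have "(2 * real n + 1) * central_ratio n * 1
      \<le> (2 * real n + 1) * central_ratio n * ((2 * real n + 3) / (2 * real n + 2))"
    by (intro mult_left_mono) (auto simp: less_imp_le)
  also have "\<dots> = (2 * real (Suc n) + 1) * central_ratio (Suc n)"
    unfolding central_ratio_Suc by (simp add: field_simps)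
  finally show ?case using step by simp
qed simp

lemma Gamma_half: "Gamma (1/2 :: real) = sqrt pi"
  using Gamma_one_half_real by simp

text \<open>Expresses the coefficients of (1 - x)^(-1/2) by generalized binomial coefficients, whose
  asymptotics are known in terms of the Gamma function.\<close>

lemma central_ratio_gchoose: "((-1/2 :: real) gchoose n) = (-1) ^ n * central_ratio n"
proof (induction n)
  case (Suc n)
  have "((-1/2 :: real) gchoose Suc n) = ((-1/2) gchoose n) * (-1/2 - real n) / real (Suc n)"
    using gbinomial_mult_1[of "-1/2::real" n] by (simp add: field_simps)
  also have "\<dots> = (-1) ^ Suc n * central_ratio (Suc n)"
    unfolding Suc.IH central_ratio_Suc by (simp add: field_simps)
  finally show ?case .
qed simp

lemma central_ratio_asymp: "(\<lambda>n. central_ratio n * sqrt (real n)) \<longlonglongrightarrow> 1 / sqrt pi"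
proof -
  have "(\<lambda>n. ((-1/2 :: real) gchoose n) / ((-1)^n / exp ((-1/2+1) * of_real (ln (real n)))))
      \<longlonglongrightarrow> inverse (Gamma (- (-1/2)))"
    by (rule gbinomial_asymptotic)
  hence "(\<lambda>n. ((-1/2 :: real) gchoose n) / ((-1)^n / exp ((-1/2+1) * of_real (ln (real n)))))
      \<longlonglongrightarrow> 1 / sqrt pi"
    by (simp add: Gamma_half inverse_eq_divide)
  moreover have "eventually (\<lambda>n. ((-1/2 :: real) gchoose n) / ((-1)^n / exp ((-1/2+1) * of_real (ln (real n))))
      = central_ratio n * sqrt (real n)) sequentially"
    using eventually_gt_at_top[of 0]
  proof eventually_elim
    case (elim n)
    have "exp ((-1/2+1) * of_real (ln (real n))) = real n powr (1/2)"
      using elim by (simp add: powr_def)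
    also have "\<dots> = sqrt (real n)" using elim by (simp add: powr_half_sqrt)
    finally have "exp ((-1/2+1) * of_real (ln (real n))) = sqrt (real n)" .
    thus ?case unfolding central_ratio_gchoose by simp
  qed
  ultimately show ?thesis by (rule Lim_transform_eventually)
qed

subsection \<open>Generating functions of sums over trees\<close>

lemma trees_with_leaves_0 [simp]: "trees_with_leaves 0 = {}"
  by (auto simp: trees_with_leaves_def)

lemma trees_with_leaves_1 [simp]: "trees_with_leaves (Suc 0) = {Leaf}"
proof -
  have "t = Leaf" if "size1 t = Suc 0" for t :: "unit tree"
    using that by (cases t) (auto simp: size1_size)
  thus ?thesis by (auto simp: trees_with_leaves_def)
qed

lemma Leaf_in_trees_with_leaves: "Leaf \<in> trees_with_leaves n \<longleftrightarrow> n = Suc 0"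
  by (auto simp: trees_with_leaves_def)

definition tree_gf :: "(unit tree \<Rightarrow> real) \<Rightarrow> real fps" where
  "tree_gf f = Abs_fps (\<lambda>n. \<Sum>t\<in>trees_with_leaves n. f t)"

lemma tree_gf_nth [simp]: "tree_gf f $ n = (\<Sum>t\<in>trees_with_leaves n. f t)"
  by (simp add: tree_gf_def)

text \<open>Splits off the value at a single leaf. What depends only on the two subtrees of the root
  then becomes a convolution, and a product of generating functions if it factors.\<close>

definition node_part :: "(unit tree \<Rightarrow> unit tree \<Rightarrow> real) \<Rightarrow> unit tree \<Rightarrow> real" where
  "node_part f t = (case t of Leaf \<Rightarrow> 0 | Node l _ r \<Rightarrow> f l r)"

lemma node_part_simps [simp]: "node_part f Leaf = 0" "node_part f (Node l x r) = f l r"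
  by (simp_all add: node_part_def)

lemma trees_with_leaves_rec:
  assumes "n \<ge> 2"
  shows "trees_with_leaves n = (\<lambda>(i, l, r). Node l () r) `
    (SIGMA i:{0..n}. trees_with_leaves i \<times> trees_with_leaves (n - i))"
proof (intro equalityI subsetI)
  fix t :: "unit tree" assume "t \<in> trees_with_leaves n"
  moreover from this obtain l x r where "t = Node l x r"
    using assms by (cases t) (auto simp: trees_with_leaves_def)
  ultimately show "t \<in> (\<lambda>(i, l, r). Node l () r) `
    (SIGMA i:{0..n}. trees_with_leaves i \<times> trees_with_leaves (n - i))"
    by (intro image_eqI[of _ _ "(size1 l, l, r)"]) (auto simp: trees_with_leaves_def)
qed (auto simp: trees_with_leaves_def)

text \<open>The boundary indices i = 0 and i = n contribute nothing, since no tree has 0 leaves;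
  keeping them matches the Cauchy product of power series.\<close>

lemma sum_node_part:
  "(\<Sum>t\<in>trees_with_leaves n. node_part f t)
     = (\<Sum>i=0..n. \<Sum>l\<in>trees_with_leaves i. \<Sum>r\<in>trees_with_leaves (n - i). f l r)"
proof (cases "n \<ge> 2")
  case True
  have inj: "inj_on (\<lambda>(i, l, r). Node l () r)
      (SIGMA i:{0..n}. trees_with_leaves i \<times> trees_with_leaves (n - i))"
    by (auto simp: inj_on_def trees_with_leaves_def)
  show ?thesis
    unfolding trees_with_leaves_rec[OF True] sum.reindex[OF inj]
    by (simp add: sum.Sigma finite_trees_with_leaves sum.cartesian_product split_def)
next
  case False
  hence "n = 0 \<or> n = 1" by auto
  thus ?thesis by auto
qed

lemma tree_gf_node_part_prod:
  "tree_gf (node_part (\<lambda>l r. f l * g r)) = tree_gf f * tree_gf g"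
  by (rule fps_ext) (simp add: sum_node_part fps_mult_nth sum_product)

lemma tree_gf_add: "tree_gf (\<lambda>t. f t + g t) = tree_gf f + tree_gf g"
  by (rule fps_ext) (simp add: sum.distrib)

lemma tree_gf_mult_left: "tree_gf (\<lambda>t. c * f t) = fps_const c * tree_gf f"
  by (rule fps_ext) (simp add: sum_distrib_left)

abbreviation "catalan_gf \<equiv> tree_gf (\<lambda>_. 1)"
abbreviation "central_gf \<equiv> Abs_fps central"

lemma catalan_gf_eq: "catalan_gf = fps_X + catalan_gf ^ 2"
proof -
  have "(\<lambda>t :: unit tree. 1 :: real) = (\<lambda>t. (if t = Leaf then 1 else 0) + node_part (\<lambda>l r. 1 * 1) t)"
    by (rule ext, rename_tac t, case_tac t) auto
  hence "catalan_gf = tree_gf (\<lambda>t. (if t = Leaf then 1 else 0) + node_part (\<lambda>l r. 1 * 1) t)"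
    by (rule arg_cong)
  hence "catalan_gf = tree_gf (\<lambda>t. if t = Leaf then 1 else 0) + catalan_gf * catalan_gf"
    by (simp only: tree_gf_add tree_gf_node_part_prod)
  moreover have "tree_gf (\<lambda>t. if t = Leaf then 1 else 0) = fps_X"
    by (rule fps_ext) (auto simp: sum.delta finite_trees_with_leaves Leaf_in_trees_with_leaves)
  ultimately show ?thesis by (simp add: power2_eq_square)
qed

text \<open>The recurrence for central binomial coefficients says that D = \<open>central_gf\<close>
  satisfies (1 - 4x) D' = 2 D. Hence (1 - 4x) D^2 has derivative 0 and equals its constant
  term.\<close>

lemma central_gf_square: "(1 - 4 * fps_X) * central_gf ^ 2 = 1"
proof -
  let ?D = "central_gf"
  have ode: "(1 - 4 * fps_X) * fps_deriv ?D = 2 * ?D"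
  proof (rule fps_ext)
    fix n
    have "((1 - 4 * fps_X) * fps_deriv ?D) $ n
        = fps_deriv ?D $ n - 4 * (fps_X * fps_deriv ?D) $ n"
      by (simp add: algebra_simps numeral_fps_const)
    also have "\<dots> = real (Suc n) * central (Suc n) - 4 * (real n * central n)"
      by (cases n) (simp_all add: fps_deriv_nth fps_X_mult_nth)
    also have "\<dots> = 2 * central n"
      unfolding central_Suc by (simp add: algebra_simps)
    finally show "((1 - 4 * fps_X) * fps_deriv ?D) $ n = (2 * ?D) $ n"
      by (simp add: numeral_fps_const)
  qed
  have "fps_deriv ((1 - 4 * fps_X) * ?D ^ 2)
      = 2 * ?D * ((1 - 4 * fps_X) * fps_deriv ?D) - 4 * ?D ^ 2"
    by (simp add: power2_eq_square algebra_simps)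
  also have "\<dots> = 0" unfolding ode by (simp add: power2_eq_square algebra_simps)
  finally have "(1 - 4 * fps_X) * ?D ^ 2 = fps_const (((1 - 4 * fps_X) * ?D ^ 2) $ 0)"
    using fps_deriv_eq_0_iff by blast
  thus ?thesis by (simp add: power2_eq_square)
qed

text \<open>The quadratic equation for the Catalan series C gives (1 - 2C)^2 = 1 - 4x, so the
  product squares to 1; its constant term selects the sign.\<close>

lemma central_gf_catalan_gf: "(1 - 2 * catalan_gf) * central_gf = 1"
proof -
  let ?y = "(1 - 2 * catalan_gf) * central_gf"
  have "(1 - 2 * catalan_gf)\<^sup>2 = 1 - 4 * (catalan_gf - catalan_gf ^ 2)"
    by (simp add: power2_eq_square algebra_simps)
  also have "catalan_gf - catalan_gf ^ 2 = fps_X"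
    using catalan_gf_eq by (simp add: algebra_simps)
  finally have "?y ^ 2 = 1" using central_gf_square by (simp add: power_mult_distrib)
  hence "?y = 1 \<or> ?y = -1" by (simp add: power2_eq_1_iff)
  moreover have "?y $ 0 = 1" by simp
  ultimately show ?thesis by fastforce
qed

text \<open>A functional that is the sum of its values on both subtrees plus a contribution R of the
  root satisfies this linear equation; dividing by 1 - 2C is multiplying by
  \<open>central_gf\<close>.\<close>

lemma tree_gf_solve: "Y = R + 2 * catalan_gf * Y \<Longrightarrow> Y = central_gf * R"
proof -
  assume "Y = R + 2 * catalan_gf * Y"
  hence "R = (1 - 2 * catalan_gf) * Y" by (simp add: algebra_simps)
  hence "central_gf * R = ((1 - 2 * catalan_gf) * central_gf) * Y" by (simp add: mult_ac)
  thus ?thesis by (simp only: central_gf_catalan_gf) simp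
qed

lemma central_gf_cube: "central_gf ^ 3 = Abs_fps (\<lambda>m. (2 * real m + 1) * central m)"
proof -
  let ?E = "Abs_fps (\<lambda>m. (2 * real m + 1) * central m)"
  have "(1 - 4 * fps_X) * ?E = central_gf"
  proof (rule fps_ext)
    fix n
    have "((1 - 4 * fps_X) * ?E) $ n = ?E $ n - 4 * (fps_X * ?E) $ n"
      by (simp add: algebra_simps numeral_fps_const)
    also have "\<dots> = central n"
      using central_Suc[of "n - 1"]
      by (cases n) (auto simp: fps_X_mult_nth algebra_simps)
    finally show "((1 - 4 * fps_X) * ?E) $ n = central_gf $ n" by simp
  qed
  hence "central_gf ^ 3 = ((1 - 4 * fps_X) * central_gf ^ 2) * ?E"
    by (simp only: power2_eq_square power3_eq_cube mult_ac)
  thus ?thesis by (simp only: central_gf_square) simp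
qed

text \<open>Comparison of coefficients in 1 - 2C = (1 - 4x) D, with C the Catalan series and D =
  \<open>central_gf\<close>.\<close>

lemma card_trees_with_leaves:
  assumes "n \<ge> 1"
  shows "real (card (trees_with_leaves n)) = central (n - 1) / real n"
proof -
  have "(1 - 2 * catalan_gf) = (1 - 2 * catalan_gf) * ((1 - 4 * fps_X) * central_gf ^ 2)"
    by (simp only: central_gf_square) simp
  also have "\<dots> = (1 - 4 * fps_X) * central_gf * ((1 - 2 * catalan_gf) * central_gf)"
    by (simp only: power2_eq_square mult_ac)
  finally have "1 - 2 * catalan_gf = (1 - 4 * fps_X) * central_gf"
    by (simp only: central_gf_catalan_gf) simp
  hence eq: "(1 - 2 * catalan_gf) $ n = ((1 - 4 * fps_X) * central_gf) $ n" by simp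
  have L: "(1 - 2 * catalan_gf) $ n = - 2 * real (card (trees_with_leaves n))"
    using assms by (simp add: numeral_fps_const)
  have "((1 - 4 * fps_X) * central_gf) $ n = central_gf $ n - 4 * (fps_X * central_gf) $ n"
    by (simp add: algebra_simps numeral_fps_const)
  also have "\<dots> = central n - 4 * central (n - 1)"
    using assms by (simp add: fps_X_mult_nth)
  finally have "- 2 * real (card (trees_with_leaves n)) = central n - 4 * central (n - 1)"
    using eq L by simp
  thus ?thesis using central_Suc[of "n - 1"] assms by (simp add: field_simps of_nat_diff)
qed

subsection \<open>Occurrences of fringe subtrees\<close>

text \<open>Counts nodes, hence fringe subtrees with multiplicity, whereas \<open>subtrees\<close>
  is a set in which equal subtrees coincide.\<close>

fun occ :: "unit tree set \<Rightarrow> unit tree \<Rightarrow> nat" where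
  "occ A Leaf = of_bool (Leaf \<in> A)"
| "occ A (Node l u r) = of_bool (Node l u r \<in> A) + occ A l + occ A r"

lemma occ_UNIV: "occ UNIV t + 1 = 2 * size1 t"
  by (induction t) auto

lemma occ_mono: "A \<subseteq> B \<Longrightarrow> occ A t \<le> occ B t"
proof (induction t)
  case (Node l u r)
  have "occ A l + occ A r \<le> occ B l + occ B r"
    using Node by (intro add_mono) auto
  with Node.prems show ?case by auto
qed auto

lemma occ_le: "occ A t \<le> 2 * size1 t"
  using occ_mono[of A UNIV t] occ_UNIV[of t] by simp

lemma occ_Un_disjoint: "A \<inter> B = {} \<Longrightarrow> occ (A \<union> B) t = occ A t + occ B t"
  by (induction t) auto

lemma occ_eq_0: "(\<And>s. s \<in> A \<Longrightarrow> size1 s > size1 t) \<Longrightarrow> occ A t = 0"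
proof (induction t)
  case (Node l u r)
  have "occ A l = 0" "occ A r = 0"
    using Node.prems by (intro Node.IH; force)+
  moreover have "Node l u r \<notin> A" using Node.prems by blast
  ultimately show ?case by simp
qed force

lemma occ_pos_iff: "occ A t > 0 \<longleftrightarrow> subtrees t \<inter> A \<noteq> {}"
  by (induction t) auto

lemma tree_gf_occ: "tree_gf (\<lambda>t. real (occ A t)) = central_gf * tree_gf (\<lambda>t. of_bool (t \<in> A))"
proof (rule tree_gf_solve)
  let ?f = "\<lambda>t. real (occ A t)"
  have "?f = (\<lambda>t. of_bool (t \<in> A) + (node_part (\<lambda>l r. ?f l * 1) t + node_part (\<lambda>l r. 1 * ?f r) t))"
    by (rule ext, rename_tac t, case_tac t) auto
  hence "tree_gf ?f = tree_gf (\<lambda>t. of_bool (t \<in> A) + (node_part (\<lambda>l r. ?f l * 1) t + node_part (\<lambda>l r. 1 * ?f r) t))"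
    by (rule arg_cong)
  also have "\<dots> = tree_gf (\<lambda>t. of_bool (t \<in> A)) + 2 * catalan_gf * tree_gf ?f"
    by (simp only: tree_gf_add tree_gf_node_part_prod) (simp add: algebra_simps)
  finally show "tree_gf ?f = tree_gf (\<lambda>t. of_bool (t \<in> A)) + 2 * catalan_gf * tree_gf ?f" .
qed

text \<open>Covers both second moments below: \<open>q\<close> is the contribution of the root, and
  the product of \<open>g l\<close> and \<open>g r\<close> is the cross term of a squared sum over
  the two subtrees.\<close>

lemma tree_gf_quadratic:
  fixes f g q :: "unit tree \<Rightarrow> real"
  assumes "\<And>t. f t = q t + (node_part (\<lambda>l r. f l * 1) t + (node_part (\<lambda>l r. 1 * f r) t
    + 2 * node_part (\<lambda>l r. g l * g r) t))"
  shows "tree_gf f = central_gf * (tree_gf q + 2 * tree_gf g ^ 2)"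
proof (rule tree_gf_solve)
  have "f = (\<lambda>t. q t + (node_part (\<lambda>l r. f l * 1) t + (node_part (\<lambda>l r. 1 * f r) t
    + 2 * node_part (\<lambda>l r. g l * g r) t)))"
    by (rule ext) (rule assms)
  hence "tree_gf f = tree_gf (\<lambda>t. q t + (node_part (\<lambda>l r. f l * 1) t + (node_part (\<lambda>l r. 1 * f r) t
    + 2 * node_part (\<lambda>l r. g l * g r) t)))"
    by (rule arg_cong)
  also have "\<dots> = tree_gf q + 2 * tree_gf g ^ 2 + 2 * catalan_gf * tree_gf f"
    by (simp only: tree_gf_add tree_gf_mult_left tree_gf_node_part_prod)
      (simp add: algebra_simps power2_eq_square numeral_fps_const)
  finally show "tree_gf f = tree_gf q + 2 * tree_gf g ^ 2 + 2 * catalan_gf * tree_gf f" .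
qed

text \<open>The first summand collects the pairs of occurrences of which one contains the other,
  including equal ones; the second collects the disjoint pairs, which are separated at their lowest
  common ancestor.\<close>

lemma tree_gf_occ_square:
  "tree_gf (\<lambda>t. real (occ A t) ^ 2) =
     central_gf * tree_gf (\<lambda>t. of_bool (t \<in> A) * (2 * real (occ A t) - 1))
     + 2 * (central_gf ^ 3 * tree_gf (\<lambda>t. of_bool (t \<in> A)) ^ 2)"
proof -
  have "tree_gf (\<lambda>t. real (occ A t) ^ 2) =
      central_gf * (tree_gf (\<lambda>t. of_bool (t \<in> A) * (2 * real (occ A t) - 1))
        + 2 * tree_gf (\<lambda>t. real (occ A t)) ^ 2)"
    by (rule tree_gf_quadratic, rename_tac t, case_tac t)
      (auto simp: power2_eq_square algebra_simps)
  thus ?thesis unfolding tree_gf_occ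
    by (simp add: algebra_simps power2_eq_square power3_eq_cube)
qed

text \<open>Distinct occurrences of trees of equal size are never nested, so that only the disjoint
  pairs remain.\<close>

lemma tree_gf_occ_pairs:
  assumes "\<And>t. t \<in> A \<Longrightarrow> size1 t = k"
  shows "tree_gf (\<lambda>t. real (occ A t) * (real (occ A t) - 1)) =
     2 * (central_gf ^ 3 * tree_gf (\<lambda>t. of_bool (t \<in> A)) ^ 2)"
proof -
  have "tree_gf (\<lambda>t. real (occ A t) * (real (occ A t) - 1)) =
      central_gf * (tree_gf (\<lambda>t. 0) + 2 * tree_gf (\<lambda>t. real (occ A t)) ^ 2)"
  proof (rule tree_gf_quadratic, goal_cases)
    case (1 t)
    show ?case
    proof (cases t)
      case (Node l u r)
      show ?thesis
      proof (cases "t \<in> A")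
        case True
        have "occ A l = 0" "occ A r = 0"
          using assms True Node by (intro occ_eq_0; force)+
        thus ?thesis using Node by auto
      qed (use Node in \<open>auto simp: algebra_simps\<close>)
    qed auto
  qed
  also have "tree_gf (\<lambda>t. 0) = 0" by (rule fps_ext) simp
  finally show ?thesis unfolding tree_gf_occ
    by (simp add: algebra_simps power2_eq_square power3_eq_cube)
qed

section \<open>Members by size, and the density of fringe subtrees\<close>

definition level_card :: "unit tree set \<Rightarrow> nat \<Rightarrow> real" where
  "level_card A n = real (card (A \<inter> trees_with_leaves n))"

lemma level_card_0 [simp]: "level_card A 0 = 0"
  by (simp add: level_card_def)

lemma level_card_nonneg [simp]: "level_card A n \<ge> 0"
  by (simp add: level_card_def)

lemma sum_of_bool_trees: "(\<Sum>t\<in>trees_with_leaves n. of_bool (t \<in> A)) = level_card A n"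
  by (simp add: level_card_def finite_trees_with_leaves Int_commute Int_def)

lemma tree_gf_of_bool: "tree_gf (\<lambda>t. of_bool (t \<in> A)) = Abs_fps (level_card A)"
  by (rule fps_ext) (simp add: sum_of_bool_trees)

lemma sum_occ:
  "(\<Sum>t\<in>trees_with_leaves n. real (occ A t)) = (\<Sum>j=0..n. level_card A j * central (n - j))"
proof -
  have "tree_gf (\<lambda>t. real (occ A t)) $ n = (tree_gf (\<lambda>t. of_bool (t \<in> A)) * central_gf) $ n"
    unfolding tree_gf_occ by (simp add: mult.commute)
  thus ?thesis unfolding tree_gf_of_bool by (simp add: fps_mult_nth)
qed

text \<open>The sum of 4^(1-j) over the members of A of size j \<le> n. For a fixed finite A its
  eventual value is the limit of the mean number of fringe subtrees in A per leaf.\<close>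

definition fringe_density :: "unit tree set \<Rightarrow> nat \<Rightarrow> real" where
  "fringe_density A n = (\<Sum>j=0..n. 4 * level_card A j / 4 ^ j)"

lemma fringe_density_nonneg: "fringe_density A n \<ge> 0"
  unfolding fringe_density_def by (intro sum_nonneg) auto

text \<open>The cube has coefficients (2m + 1) \<open>central m\<close>. After division by 4^m they
  increase, so each may be replaced by the one at index n - 1. What remains is a convolution of
  weights, at most the square of their sum. The leading constant is kept exact, because it must
  cancel in the variance.\<close>

lemma cubic_term_le:
  assumes n: "n \<ge> 1"
  shows "2 * (central_gf ^ 3 * tree_gf (\<lambda>t. of_bool (t \<in> A)) ^ 2) $ n
    \<le> (real n * fringe_density A n) ^ 2 * real (card (trees_with_leaves n))"
proof -
  let ?a = "level_card A"
  define a2 where "a2 j = (\<Sum>i=0..j. ?a i * ?a (j - i))" for j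
  have a2_nonneg: "a2 j \<ge> 0" for j unfolding a2_def by (intro sum_nonneg) auto
  have a20: "a2 0 = 0" by (simp add: a2_def)
  have "(central_gf ^ 3 * tree_gf (\<lambda>t. of_bool (t \<in> A)) ^ 2) $ n
      = (Abs_fps ?a ^ 2 * central_gf ^ 3) $ n"
    unfolding tree_gf_of_bool by (simp add: mult.commute)
  also have "\<dots> = (\<Sum>j=0..n. a2 j * ((2 * real (n - j) + 1) * central (n - j)))"
    by (simp add: central_gf_cube power2_eq_square fps_mult_nth a2_def)
  also have "\<dots> \<le> (\<Sum>j=0..n. a2 j * (((2 * real (n-1) + 1) * central_ratio (n-1)) * 4 ^ n / 4 ^ j))"
  proof (intro sum_mono)
    fix j assume j: "j \<in> {0..n}"
    show "a2 j * ((2 * real (n - j) + 1) * central (n - j))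
      \<le> a2 j * (((2 * real (n-1) + 1) * central_ratio (n-1)) * 4 ^ n / 4 ^ j)"
    \<comment> \<open>For j = 0 the index n lies beyond n - 1, but \<open>a2\<close> vanishes
      there.\<close>
    proof (cases "j = 0")
      case False
      have "(2 * real (n - j) + 1) * central (n - j)
          = (2 * real (n - j) + 1) * central_ratio (n - j) * (4 ^ n / 4 ^ j)"
        using j by (simp add: central_eq power_diff)
      also have "\<dots> \<le> (2 * real (n - 1) + 1) * central_ratio (n - 1) * (4 ^ n / 4 ^ j)"
        using False j by (intro mult_right_mono central_ratio_weighted_mono) auto
      finally show ?thesis using a2_nonneg by (intro mult_left_mono) auto
    qed (simp add: a20)
  qed
  also have "\<dots> = (2 * real (n-1) + 1) * central_ratio (n-1) * 4 ^ n * (\<Sum>j=0..n. a2 j / 4 ^ j)"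
    by (simp add: sum_distrib_left mult_ac)
  also have "\<dots> \<le> (2 * real n * central_ratio (n-1) * 4 ^ n) * (fringe_density A n ^ 2 / 16)"
  proof (intro mult_mono)
    have "(\<Sum>j=0..n. a2 j / 4 ^ j)
        = (\<Sum>j=0..n. \<Sum>i=0..j. (?a i / 4 ^ i) * (?a (j - i) / 4 ^ (j - i)))"
      unfolding a2_def sum_divide_distrib
      by (intro sum.cong refl) (simp add: power_add[symmetric])
    also have "\<dots> = (\<Sum>(j,i)\<in>(SIGMA j:{0..n}. {0..j}). (?a i / 4 ^ i) * (?a (j - i) / 4 ^ (j - i)))"
      by (subst sum.Sigma) auto
    also have "\<dots> = (\<Sum>(i,k)\<in>{(i,k). i + k \<le> n}. (?a i / 4 ^ i) * (?a k / 4 ^ k))"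
      by (rule sum.reindex_bij_witness[of _ "\<lambda>(i,k). (i+k,i)" "\<lambda>(j,i). (i,j-i)"]) auto
    \<comment> \<open>The triangle i + k \<le> n is enlarged to the full square, over which the sum
      factors.\<close>
    also have "\<dots> \<le> (\<Sum>(i,k)\<in>{0..n}\<times>{0..n}. (?a i / 4 ^ i) * (?a k / 4 ^ k))"
      by (intro sum_mono2) auto
    also have "\<dots> = fringe_density A n ^ 2 / 16"
    proof -
      have "fringe_density A n = 4 * (\<Sum>j=0..n. ?a j / 4 ^ j)"
        by (simp add: fringe_density_def sum_distrib_left)
      thus ?thesis by (simp add: power2_eq_square sum_product sum.cartesian_product)
    qed
    finally show "(\<Sum>j=0..n. a2 j / 4 ^ j) \<le> fringe_density A n ^ 2 / 16" .
  qed (use n in \<open>auto intro!: mult_right_mono sum_nonneg divide_nonneg_nonneg a2_nonneg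
        simp: less_imp_le\<close>)
  finally have "2 * (central_gf ^ 3 * tree_gf (\<lambda>t. of_bool (t \<in> A)) ^ 2) $ n
     \<le> 2 * ((2 * real n * central_ratio (n-1) * 4 ^ n) * (fringe_density A n ^ 2 / 16))"
    by simp
  also have "\<dots> = (real n * fringe_density A n) ^ 2 * real (card (trees_with_leaves n))"
    using n by (cases n) (simp_all add: card_trees_with_leaves central_eq power2_eq_square field_simps)
  finally show ?thesis .
qed

subsection \<open>Moments for the random tree\<close>

abbreviation tree_E :: "nat \<Rightarrow> (unit tree \<Rightarrow> real) \<Rightarrow> real" where
  "tree_E n f \<equiv> measure_pmf.expectation (random_tree n) f"

abbreviation tree_P :: "nat \<Rightarrow> unit tree set \<Rightarrow> real" where
  "tree_P n \<equiv> measure_pmf.prob (random_tree n)"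

lemma set_random_tree: "n \<ge> 1 \<Longrightarrow> set_pmf (random_tree n) = trees_with_leaves n"
  by (simp add: random_tree_def trees_with_leaves_nonempty finite_trees_with_leaves)

lemma integrable_random_tree [simp]:
  "n \<ge> 1 \<Longrightarrow> integrable (measure_pmf (random_tree n)) (f :: unit tree \<Rightarrow> real)"
  by (intro integrable_measure_pmf_finite) (simp add: set_random_tree finite_trees_with_leaves)

lemma tree_E_eq:
  "n \<ge> 1 \<Longrightarrow> tree_E n f = (\<Sum>t\<in>trees_with_leaves n. f t) / real (card (trees_with_leaves n))"
  by (simp add: random_tree_def integral_pmf_of_set trees_with_leaves_nonempty finite_trees_with_leaves)

lemma card_trees_pos: "n \<ge> 1 \<Longrightarrow> real (card (trees_with_leaves n)) > 0"
  by (simp add: card_gt_0_iff trees_with_leaves_nonempty finite_trees_with_leaves)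

lemma tree_E_mono:
  "n \<ge> 1 \<Longrightarrow> (\<And>t. t \<in> trees_with_leaves n \<Longrightarrow> f t \<le> g t) \<Longrightarrow> tree_E n f \<le> tree_E n g"
  by (simp add: tree_E_eq divide_right_mono sum_mono)

text \<open>The right side is the sum in \<open>sum_occ\<close> with the factor
  \<open>central_ratio (n - j)\<close> frozen at index n - 1, ready for termwise comparison.\<close>

lemma fringe_density_times_card:
  assumes n: "n \<ge> 1"
  shows "real n * fringe_density A n * real (card (trees_with_leaves n))
     = (\<Sum>j=0..n. level_card A j * (4 ^ n / 4 ^ j * central_ratio (n-1)))"
proof -
  obtain m where m: "n = Suc m" using n by (cases n) auto
  have "real n * fringe_density A n * real (card (trees_with_leaves n))
      = fringe_density A n * (4 ^ m * central_ratio m)"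
    using n by (simp add: card_trees_with_leaves m central_eq)
  also have "\<dots> = (\<Sum>j=0..n. (4 * level_card A j / 4 ^ j) * (4 ^ m * central_ratio m))"
    unfolding fringe_density_def by (rule sum_distrib_right)
  also have "\<dots> = (\<Sum>j=0..n. level_card A j * (4 ^ n / 4 ^ j * central_ratio (n-1)))"
    by (intro sum.cong refl) (simp add: m)
  finally show ?thesis .
qed

lemma tree_E_occ_ge:
  assumes n: "n \<ge> 1"
  shows "tree_E n (\<lambda>t. real (occ A t)) \<ge> real n * fringe_density A n"
proof -
  have "real n * fringe_density A n * real (card (trees_with_leaves n))
     = (\<Sum>j=0..n. level_card A j * (4 ^ n / 4 ^ j * central_ratio (n-1)))"
    by (rule fringe_density_times_card[OF n])
  also have "\<dots> \<le> (\<Sum>j=0..n. level_card A j * central (n - j))"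
  proof (intro sum_mono)
    fix j assume j: "j \<in> {0..n}"
    show "level_card A j * (4 ^ n / 4 ^ j * central_ratio (n-1)) \<le> level_card A j * central (n - j)"
    proof (cases "j = 0")
      case False
      have "4 ^ n / 4 ^ j * central_ratio (n-1) \<le> 4 ^ n / 4 ^ j * central_ratio (n-j)"
        using False j by (intro mult_left_mono central_ratio_antimono) auto
      also have "\<dots> = central (n - j)"
        using j by (simp add: central_eq power_diff)
      finally show ?thesis by (intro mult_left_mono) auto
    qed auto
  qed
  finally show ?thesis using card_trees_pos[OF n] n
    by (simp add: tree_E_eq sum_occ pos_le_divide_eq)
qed

text \<open>Reverses \<open>tree_E_occ_ge\<close> by weighted monotonicity, at the price of a factor
  close to 1 when K is small compared with n.\<close>

lemma tree_E_occ_le: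
  assumes n: "n \<ge> 1" and A: "\<And>t. t \<in> A \<Longrightarrow> size1 t \<le> K" and K: "K \<le> n"
  shows "tree_E n (\<lambda>t. real (occ A t))
    \<le> real n * fringe_density A n * ((2 * real n - 1) / (2 * real (n - K) + 1))"
proof -
  let ?q = "(2 * real n - 1) / (2 * real (n - K) + 1)"
  have "(\<Sum>j=0..n. level_card A j * central (n - j))
      \<le> (\<Sum>j=0..n. level_card A j * (4 ^ n / 4 ^ j * central_ratio (n-1) * ?q))"
  proof (intro sum_mono)
    fix j assume j: "j \<in> {0..n}"
    show "level_card A j * central (n - j)
      \<le> level_card A j * (4 ^ n / 4 ^ j * central_ratio (n-1) * ?q)"
    proof (cases "j = 0 \<or> j > K")
      case True
      hence "level_card A j = 0"
      proof
        assume "j > K"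
        hence "A \<inter> trees_with_leaves j = {}" using A by (force simp: trees_with_leaves_def)
        thus ?thesis by (simp add: level_card_def)
      qed simp
      thus ?thesis by simp
    next
      case False
      have "(2 * real (n - K) + 1) * central_ratio (n - j) \<le> (2 * real (n - j) + 1) * central_ratio (n - j)"
        using False j by (intro mult_right_mono) (auto simp: less_imp_le)
      also have "\<dots> \<le> (2 * real (n - 1) + 1) * central_ratio (n - 1)"
        using False j by (intro central_ratio_weighted_mono) auto
      also have "\<dots> = (2 * real n - 1) * central_ratio (n - 1)"
        using n by (simp add: of_nat_diff)
      finally have *: "central_ratio (n - j) \<le> central_ratio (n-1) * ?q"
        by (simp add: field_simps)
      have "central (n - j) = 4 ^ n / 4 ^ j * central_ratio (n-j)"
        using j by (simp add: central_eq power_diff)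
      also have "\<dots> \<le> 4 ^ n / 4 ^ j * (central_ratio (n-1) * ?q)"
        using * by (intro mult_left_mono) auto
      finally show ?thesis by (intro mult_left_mono) (auto simp: mult_ac)
    qed
  qed
  also have "\<dots> = (\<Sum>j=0..n. level_card A j * (4 ^ n / 4 ^ j * central_ratio (n-1))) * ?q"
    by (simp only: sum_distrib_right mult.assoc)
  also have "\<dots> = real n * fringe_density A n * real (card (trees_with_leaves n)) * ?q"
    by (simp only: fringe_density_times_card[OF n, of A])
  also have "\<dots> = real n * fringe_density A n * ?q * real (card (trees_with_leaves n))"
    by (simp only: mult_ac)
  finally show ?thesis using card_trees_pos[OF n] n
    by (simp add: tree_E_eq sum_occ pos_divide_le_eq)
qed

lemma tree_E_occ_pairs_le:
  assumes n: "n \<ge> 1" and A: "\<And>t. t \<in> A \<Longrightarrow> size1 t = k"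
  shows "tree_E n (\<lambda>t. real (occ A t) * (real (occ A t) - 1))
    \<le> (real n * (4 * real (card A) / 4 ^ k)) ^ 2"
proof -
  have AT: "A \<subseteq> trees_with_leaves k" using A by (auto simp: trees_with_leaves_def)
  hence fin: "finite A" using finite_trees_with_leaves finite_subset by blast
  have lc: "level_card A j = (if j = k then real (card A) else 0)" for j
  proof (cases "j = k")
    case False
    hence "A \<inter> trees_with_leaves j = {}" using A by (auto simp: trees_with_leaves_def)
    with False show ?thesis by (simp add: level_card_def)
  qed (use AT in \<open>simp add: level_card_def Int_absorb2\<close>)
  \<comment> \<open>Equality holds for k \<le> n; for k > n the truncated sum is 0.\<close>
  have "fringe_density A n \<le> 4 * real (card A) / 4 ^ k"
    by (auto simp: fringe_density_def lc if_distrib[of "\<lambda>x. 4 * x / _"] cong: if_cong)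
  hence le: "(real n * fringe_density A n) ^ 2 \<le> (real n * (4 * real (card A) / 4 ^ k)) ^ 2"
    by (intro power_mono mult_left_mono) (auto simp: fringe_density_nonneg)
  have "(\<Sum>t\<in>trees_with_leaves n. real (occ A t) * (real (occ A t) - 1))
     = tree_gf (\<lambda>t. real (occ A t) * (real (occ A t) - 1)) $ n" by simp
  also have "\<dots> = 2 * (central_gf ^ 3 * tree_gf (\<lambda>t. of_bool (t \<in> A)) ^ 2) $ n"
  proof -
    have "tree_gf (\<lambda>t. real (occ A t) * (real (occ A t) - 1)) =
        2 * (central_gf ^ 3 * tree_gf (\<lambda>t. of_bool (t \<in> A)) ^ 2)"
      by (rule tree_gf_occ_pairs) (rule A)
    thus ?thesis by (simp only:) (simp add: numeral_fps_const)
  qed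
  also have "\<dots> \<le> (real n * fringe_density A n) ^ 2 * real (card (trees_with_leaves n))"
    by (rule cubic_term_le[OF n])
  finally have "tree_E n (\<lambda>t. real (occ A t) * (real (occ A t) - 1)) \<le> (real n * fringe_density A n) ^ 2"
    using card_trees_pos[OF n] n by (simp add: tree_E_eq pos_divide_le_eq)
  with le show ?thesis by linarith
qed

text \<open>The disjoint pairs contribute at most the squared lower bound for the mean, so that only the
  nested pairs enter the variance.\<close>

lemma tree_variance_occ_le:
  assumes n: "n \<ge> 1" and A: "\<And>t. t \<in> A \<Longrightarrow> size1 t \<le> M"
  shows "measure_pmf.variance (random_tree n) (\<lambda>t. real (occ A t)) \<le> 8 * real M * real n"
proof -
  let ?f = "\<lambda>t. real (occ A t)" and ?C = "real (card (trees_with_leaves n))"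
  have "(central_gf * tree_gf (\<lambda>t. of_bool (t \<in> A) * (2 * ?f t - 1))) $ n
      = (tree_gf (\<lambda>t. of_bool (t \<in> A) * (2 * ?f t - 1)) * central_gf) $ n"
    by (simp add: mult.commute)
  also have "\<dots> = (\<Sum>j=0..n. (\<Sum>t\<in>trees_with_leaves j. of_bool (t \<in> A) * (2 * ?f t - 1)) * central (n - j))"
    by (simp add: fps_mult_nth)
  \<comment> \<open>A tree in A has at most M leaves, hence fewer than 2M nodes among which members
    of A can be rooted.\<close>
  also have "\<dots> \<le> (\<Sum>j=0..n. (\<Sum>t\<in>trees_with_leaves j. of_bool (t \<in> A) * (4 * real M)) * central (n - j))"
  proof (intro sum_mono mult_right_mono)
    fix j t assume "t \<in> trees_with_leaves j"
    show "of_bool (t \<in> A) * (2 * ?f t - 1) \<le> of_bool (t \<in> A) * (4 * real M)"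
      using A[of t] occ_le[of A t] by auto
  qed (auto simp: less_imp_le)
  also have "\<dots> = 4 * real M * (\<Sum>t\<in>trees_with_leaves n. ?f t)"
    unfolding sum_distrib_right[symmetric] sum_of_bool_trees sum_occ
    by (simp add: sum_distrib_left mult_ac)
  finally have nested: "(central_gf * tree_gf (\<lambda>t. of_bool (t \<in> A) * (2 * ?f t - 1))) $ n
     \<le> 4 * real M * (\<Sum>t\<in>trees_with_leaves n. ?f t)" .
  have "(\<Sum>t\<in>trees_with_leaves n. ?f t ^ 2) = tree_gf (\<lambda>t. ?f t ^ 2) $ n" by simp
  also have "\<dots> = (central_gf * tree_gf (\<lambda>t. of_bool (t \<in> A) * (2 * ?f t - 1))) $ n
      + 2 * (central_gf ^ 3 * tree_gf (\<lambda>t. of_bool (t \<in> A)) ^ 2) $ n"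
    unfolding tree_gf_occ_square by (simp add: numeral_fps_const)
  also have "\<dots> \<le> 4 * real M * (\<Sum>t\<in>trees_with_leaves n. ?f t)
      + (real n * fringe_density A n) ^ 2 * ?C"
    by (intro add_mono nested cubic_term_le n)
  finally have "tree_E n (\<lambda>t. ?f t ^ 2) \<le> 4 * real M * tree_E n ?f + (real n * fringe_density A n) ^ 2"
    using card_trees_pos[OF n] n by (simp add: tree_E_eq divide_simps)
  moreover have "(real n * fringe_density A n) ^ 2 \<le> tree_E n ?f ^ 2"
    using tree_E_occ_ge[OF n, of A] by (intro power_mono) (auto simp: fringe_density_nonneg)
  moreover have "4 * real M * tree_E n ?f \<le> 4 * real M * tree_E n (\<lambda>_. 2 * real n)"
  proof (intro mult_left_mono tree_E_mono n)
    fix t assume "t \<in> trees_with_leaves n"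
    thus "?f t \<le> 2 * real n" using occ_le[of A t] by (simp add: trees_with_leaves_def)
  qed simp
  moreover have "measure_pmf.variance (random_tree n) ?f = tree_E n (\<lambda>t. ?f t ^ 2) - tree_E n ?f ^ 2"
    using n by (intro measure_pmf.variance_eq) auto
  ultimately show ?thesis by simp
qed

lemma tree_P_occ_deviation:
  assumes n: "n \<ge> 1" and A: "\<And>t. t \<in> A \<Longrightarrow> size1 t \<le> M" and a: "a > 0"
  shows "tree_P n {t. a \<le> \<bar>real (occ A t) - tree_E n (\<lambda>t. real (occ A t))\<bar>}
    \<le> 8 * real M * real n / a\<^sup>2"
proof -
  have "tree_P n {t. a \<le> \<bar>real (occ A t) - tree_E n (\<lambda>t. real (occ A t))\<bar>}
      \<le> measure_pmf.variance (random_tree n) (\<lambda>t. real (occ A t)) / a\<^sup>2"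
    using measure_pmf.Chebyshev_inequality[of "\<lambda>t. real (occ A t)" "random_tree n" a] n a
    by simp
  also have "\<dots> \<le> 8 * real M * real n / a\<^sup>2"
    using tree_variance_occ_le[OF n A] by (intro divide_right_mono) auto
  finally show ?thesis .
qed

lemma tree_P_Markov:
  assumes n: "n \<ge> 1" and f: "\<And>t. f t \<ge> 0" and a: "a > 0"
  shows "tree_P n {t. a \<le> f t} \<le> tree_E n f / a"
  using integral_Markov_inequality_measure[of "measure_pmf (random_tree n)" f "{}" a] n f a by simp

subsection \<open>Isomorphism classes\<close>

lemma tree_iso_size1: "tree_iso s t \<Longrightarrow> size1 s = size1 t"
  by (induction rule: tree_iso.induct) auto

lemma tree_iso_height: "tree_iso s t \<Longrightarrow> height s = height t"
  by (induction rule: tree_iso.induct) auto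

abbreviation iso_class :: "unit tree \<Rightarrow> unit tree set" where
  "iso_class t \<equiv> {s. tree_iso t s}"

text \<open>The orbit size under swapping children: a node doubles it exactly when its children are
  not isomorphic.\<close>

fun class_size :: "unit tree \<Rightarrow> nat" where
  "class_size Leaf = 1"
| "class_size (Node l u r) = (if tree_iso l r then 1 else 2) * class_size l * class_size r"

lemma class_size_pos [simp]: "class_size t > 0"
  by (induction t) auto

lemma iso_class_Leaf: "iso_class Leaf = {Leaf}"
  by (auto elim: tree_iso.cases intro: tree_iso.intros)

lemma iso_class_Node: "iso_class (Node l u r) =
    (\<lambda>(a, b). Node a () b) ` (iso_class l \<times> iso_class r) \<union>
    (\<lambda>(a, b). Node a () b) ` (iso_class r \<times> iso_class l)" (is "_ = ?R")
proof (intro equalityI subsetI)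
  fix s assume "s \<in> iso_class (Node l u r)"
  hence "tree_iso (Node l u r) s" by simp
  thus "s \<in> ?R" by cases auto
qed (auto intro: tree_iso.intros)

lemma iso_class_eq: "tree_iso s t \<Longrightarrow> iso_class s = iso_class t"
  using tree_iso_trans tree_iso_sym by blast

text \<open>The two families of ordered pairs of children, class of l before class of r and
  conversely, coincide if l and r are isomorphic and are disjoint otherwise.\<close>

lemma finite_card_iso_class: "finite (iso_class t) \<and> card (iso_class t) = class_size t"
proof (induction t)
  case Leaf
  show ?case unfolding iso_class_Leaf by simp
next
  case (Node l u r)
  let ?N = "\<lambda>(a, b). Node a () b"
  have inj: "inj_on ?N X" for X by (auto simp: inj_on_def)
  have fin: "finite (?N ` (iso_class l \<times> iso_class r))" "finite (?N ` (iso_class r \<times> iso_class l))"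
    using Node by auto
  have card: "card (?N ` (iso_class l \<times> iso_class r)) = class_size l * class_size r"
    "card (?N ` (iso_class r \<times> iso_class l)) = class_size l * class_size r"
    using Node by (simp_all add: card_image[OF inj] card_cartesian_product)
  show ?case
  proof (cases "tree_iso l r")
    case True
    have "iso_class r = iso_class l" using iso_class_eq[OF True] by simp
    with True fin card show ?thesis unfolding iso_class_Node by simp
  next
    case False
    have "?N ` (iso_class l \<times> iso_class r) \<inter> ?N ` (iso_class r \<times> iso_class l) = {}"
    proof -
      have "\<not> (tree_iso l a \<and> tree_iso r a)" for a
        using False tree_iso_sym tree_iso_trans by blast
      thus ?thesis by auto
    qed
    hence "card (iso_class (Node l u r)) = 2 * (class_size l * class_size r)"
      unfolding iso_class_Node using fin card by (simp add: card_Un_disjoint)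
    thus ?thesis using False fin by (simp add: iso_class_Node)
  qed
qed

lemma finite_iso_class [simp]: "finite (iso_class t)"
  and card_iso_class: "card (iso_class t) = class_size t"
  using finite_card_iso_class by blast+

lemma tree_iso_class_size: "tree_iso s t \<Longrightarrow> class_size s = class_size t"
  using iso_class_eq card_iso_class by metis

text \<open>Each of the \<open>size t\<close> inner nodes contributes a factor 2, to the class size
  or to the power of 2 according to whether its children are isomorphic.\<close>

lemma class_size_symmetric_nodes:
  "class_size t * 2 ^ occ {Node l u r | l u r. tree_iso l r} t = 2 ^ size t"
proof (induction t)
  case (Node l u r)
  let ?S = "{Node l u r | l u r. tree_iso l r}"
  have "2 ^ size (Node l u r) = 2 * (2 ^ size l * 2 ^ size r :: nat)" by (simp add: power_add)
  also have "\<dots> = 2 * ((class_size l * 2 ^ occ ?S l) * (class_size r * 2 ^ occ ?S r))"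
    by (simp only: Node.IH)
  also have "\<dots> = class_size (Node l u r) * 2 ^ occ ?S (Node l u r)"
    by (simp add: power_add mult_ac)
  finally show ?case by simp
qed simp

subsection \<open>Generating functions of powers of the class size\<close>

text \<open>Truncation by height gives finite sets closed under isomorphism in which the two
  children range independently. The generating functions thus become increasing sequences of finite
  sums.\<close>

definition bounded_height :: "nat \<Rightarrow> unit tree set" where
  "bounded_height d = {t. height t \<le> d}"

lemma bounded_height_0: "bounded_height 0 = {Leaf}"
  by (auto simp: bounded_height_def)

lemma bounded_height_Suc: "bounded_height (Suc d) =
    insert Leaf ((\<lambda>(l, r). Node l () r) ` (bounded_height d \<times> bounded_height d))" (is "_ = ?R")
proof (intro equalityI subsetI)
  fix t :: "unit tree" assume "t \<in> bounded_height (Suc d)"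
  thus "t \<in> ?R" by (cases t) (auto simp: bounded_height_def)
qed (auto simp: bounded_height_def)

lemma finite_bounded_height [simp]: "finite (bounded_height d)"
  by (induction d) (auto simp: bounded_height_0 bounded_height_Suc)

lemma bounded_height_iso:
  "t \<in> bounded_height d \<Longrightarrow> {s \<in> bounded_height d. tree_iso t s} = iso_class t"
  by (auto simp: bounded_height_def tree_iso_height)

text \<open>With \<open>x\<close> marking leaves; the exponent -1 counts isomorphism classes, and 0 ordered trees.\<close>

definition iso_sum :: "int \<Rightarrow> real \<Rightarrow> nat \<Rightarrow> real" where
  "iso_sum e x d = (\<Sum>t\<in>bounded_height d. real (class_size t) powi e * x ^ size1 t)"

lemma iso_sum_0 [simp]: "iso_sum e x 0 = x"
  by (simp add: iso_sum_def bounded_height_0)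

lemma iso_sum_nonneg: "x \<ge> 0 \<Longrightarrow> iso_sum e x d \<ge> 0"
  unfolding iso_sum_def by (intro sum_nonneg) auto

lemma sum_over_iso_pairs:
  "(\<Sum>l\<in>bounded_height d. \<Sum>r\<in>bounded_height d. of_bool (tree_iso l r) * g l r)
     = (\<Sum>l\<in>bounded_height d. \<Sum>r\<in>iso_class l. (g l r :: real))"
proof (rule sum.cong[OF refl])
  fix l assume l: "l \<in> bounded_height d"
  have "(\<Sum>r\<in>bounded_height d. of_bool (tree_iso l r) * g l r)
      = (\<Sum>r\<in>bounded_height d. if tree_iso l r then g l r else 0)"
    by (intro sum.cong) auto
  also have "\<dots> = (\<Sum>r\<in>{r \<in> bounded_height d. tree_iso l r}. g l r)"
    by (subst sum.inter_filter) auto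
  finally show "(\<Sum>r\<in>bounded_height d. of_bool (tree_iso l r) * g l r) = (\<Sum>r\<in>iso_class l. g l r)"
    by (simp only: bounded_height_iso[OF l])
qed

text \<open>The factor 2^e at the root must be corrected for isomorphic children. Each l has
  \<open>class_size l\<close> isomorphic partners with the same weight, which raises the exponent to
  2e + 1 and squares x. For e = -1 the limit is the classical equation s(x) = x + s(x)^2/2 +
  s(x^2)/2 for unordered binary trees.\<close>

lemma iso_sum_Suc:
  "iso_sum e x (Suc d) =
     x + 2 powi e * iso_sum e x d ^ 2 + (1 - 2 powi e) * iso_sum (2 * e + 1) (x ^ 2) d"
proof -
  let ?H = "bounded_height d" and ?N = "\<lambda>(l, r). Node l () r"
  define f where "f t = real (class_size t) powi e * x ^ size1 t" for t
  have inj: "inj_on ?N (?H \<times> ?H)" by (auto simp: inj_on_def)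
  have node: "f (Node l () r) = 2 powi e * (f l * f r)
      + (1 - 2 powi e) * (of_bool (tree_iso l r) * (f l * f r))" for l r
    by (simp add: f_def power_int_mult_distrib power_add algebra_simps)
  have "iso_sum e x (Suc d) = f Leaf + (\<Sum>t\<in>?N ` (?H \<times> ?H). f t)"
    unfolding iso_sum_def bounded_height_Suc f_def[symmetric] by (subst sum.insert) auto
  also have "(\<Sum>t\<in>?N ` (?H \<times> ?H). f t) = (\<Sum>l\<in>?H. \<Sum>r\<in>?H. f (Node l () r))"
    by (subst sum.reindex[OF inj]) (simp add: sum.cartesian_product split_def)
  also have "\<dots> = 2 powi e * (\<Sum>l\<in>?H. \<Sum>r\<in>?H. f l * f r)
      + (1 - 2 powi e) * (\<Sum>l\<in>?H. \<Sum>r\<in>?H. of_bool (tree_iso l r) * (f l * f r))"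
    unfolding node by (simp only: sum.distrib flip: sum_distrib_left)
  also have "(\<Sum>l\<in>?H. \<Sum>r\<in>?H. f l * f r) = iso_sum e x d ^ 2"
    by (simp add: iso_sum_def f_def power2_eq_square sum_product)
  also have "(\<Sum>l\<in>?H. \<Sum>r\<in>?H. of_bool (tree_iso l r) * (f l * f r)) = iso_sum (2 * e + 1) (x ^ 2) d"
    unfolding iso_sum_def sum_over_iso_pairs
  proof (intro sum.cong refl)
    fix l
    have eq: "f r = f l" if "r \<in> iso_class l" for r
    proof -
      have "tree_iso l r" using that by simp
      thus ?thesis by (simp add: f_def tree_iso_class_size[of l r] tree_iso_size1[of l r])
    qed
    have "(\<Sum>r\<in>iso_class l. f l * f r) = (\<Sum>r\<in>iso_class l. f l * f l)"
      using eq by (intro sum.cong) auto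
    also have "\<dots> = real (class_size l) * (f l * f l)"
      by (simp only: sum_constant card_iso_class)
    also have "\<dots> = real (class_size l) powi (2 * e + 1) * (x ^ 2) ^ size1 l"
    proof -
      have "real (class_size l) powi (1 + (e + e))
          = real (class_size l) * (real (class_size l) powi e * real (class_size l) powi e)"
      proof -
        have "real (class_size l) powi (e + e) = real (class_size l) powi e * real (class_size l) powi e"
          by (rule power_int_add) simp
        moreover have "real (class_size l) powi (1 + (e + e))
            = real (class_size l) powi 1 * real (class_size l) powi (e + e)"
          by (rule power_int_add) simp
        ultimately show ?thesis by simp
      qed
      moreover have "2 * e + 1 = 1 + (e + e)" by simp
      ultimately have "real (class_size l) powi (2 * e + 1)
          = real (class_size l) * (real (class_size l) powi e * real (class_size l) powi e)"
        by (simp only:)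
      thus ?thesis
        by (simp add: f_def power2_eq_square power_mult_distrib mult_ac)
    qed
    finally show "(\<Sum>r\<in>iso_class l. f l * f r) = \<dots>" .
  qed
  finally show ?thesis by (simp add: f_def)
qed

lemma iso_sum_mono: "x \<ge> 0 \<Longrightarrow> d \<le> d' \<Longrightarrow> iso_sum e x d \<le> iso_sum e x d'"
  unfolding iso_sum_def by (intro sum_mono2 finite_bounded_height) (auto simp: bounded_height_def)

subsection \<open>Counting classes of fringe subtrees\<close>

lemma tree_iso_rel_Image: "tree_iso_rel `` {t} = iso_class t"
  by (auto simp: tree_iso_rel_def)

lemma quotient_iso: "A // tree_iso_rel = iso_class ` A"
  by (auto simp: quotient_def tree_iso_rel_Image)

lemma Union_quotient_iso:
  assumes "\<And>s t. s \<in> A \<Longrightarrow> tree_iso s t \<Longrightarrow> t \<in> A"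
  shows "\<Union>(A // tree_iso_rel) = A"
  using assms by (auto simp: quotient_iso intro: tree_iso_refl)

lemma disjoint_quotient_iso: "c \<in> A // tree_iso_rel \<Longrightarrow> c' \<in> A // tree_iso_rel \<Longrightarrow> c \<noteq> c' \<Longrightarrow> c \<inter> c' = {}"
  using quotient_disj[OF equiv_tree_iso_rel, of c c'] by (auto simp: quotient_def)

lemma finite_class: "c \<in> A // tree_iso_rel \<Longrightarrow> finite c"
  by (auto simp: quotient_iso)

lemma sum_quotient_iso:
  assumes "finite A" and closed: "\<And>s t. s \<in> A \<Longrightarrow> tree_iso s t \<Longrightarrow> t \<in> A"
  shows "(\<Sum>c\<in>A // tree_iso_rel. \<Sum>t\<in>c. g t) = (\<Sum>t\<in>A. (g t :: real))"
proof -
  have "(\<Sum>t\<in>\<Union>(A // tree_iso_rel). g t) = (\<Sum>c\<in>A // tree_iso_rel. \<Sum>t\<in>c. g t)"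
    by (subst sum.Union_disjoint) (auto simp: finite_class dest: disjoint_quotient_iso)
  thus ?thesis using Union_quotient_iso[of A] closed by simp
qed

text \<open>Turns sums over classes into sums over trees: inverse class sizes count classes, class
  sizes count ordered pairs of isomorphic trees.\<close>

lemma sum_inverse_class_size:
  assumes "c \<in> A // tree_iso_rel"
  shows "(\<Sum>t\<in>c. inverse (real (class_size t))) = 1"
    and "(\<Sum>t\<in>c. real (class_size t)) = real (card c) ^ 2"
proof -
  obtain s where s: "c = iso_class s" using assms by (auto simp: quotient_iso)
  have *: "class_size t = class_size s" if "t \<in> c" for t
    using that by (auto simp: s dest: tree_iso_class_size)
  have "(\<Sum>t\<in>c. inverse (real (class_size t))) = (\<Sum>t\<in>c. inverse (real (class_size s)))"
    by (intro sum.cong refl) (simp add: *)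
  thus "(\<Sum>t\<in>c. inverse (real (class_size t))) = 1" by (simp add: s card_iso_class)
  have "(\<Sum>t\<in>c. real (class_size t)) = (\<Sum>t\<in>c. real (class_size s))"
    by (intro sum.cong refl) (simp add: *)
  thus "(\<Sum>t\<in>c. real (class_size t)) = real (card c) ^ 2"
    by (simp add: s card_iso_class power2_eq_square)
qed

lemma size1_less_bounded_height: "{t. size1 t < K} \<subseteq> bounded_height K"
proof
  fix t :: "unit tree" assume "t \<in> {t. size1 t < K}"
  thus "t \<in> bounded_height K"
    using height_le_size_tree[of t] by (simp add: bounded_height_def size1_size)
qed

text \<open>A coefficient bound from the value of the generating function at x: since x \<le> 1,
  every tree with fewer than K leaves has weight at least x^K there.\<close>

lemma card_small_classes_le:
  assumes x: "0 < x" "x \<le> 1" and bound: "\<And>d. iso_sum (-1) x d \<le> B"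
  shows "real (card ({t. size1 t < K} // tree_iso_rel)) \<le> B / x ^ K"
proof -
  let ?A = "{t :: unit tree. size1 t < K}"
  note sub = size1_less_bounded_height[of K]
  have fin: "finite ?A" by (rule finite_subset[OF sub]) simp
  have "real (card (?A // tree_iso_rel)) = (\<Sum>c\<in>?A // tree_iso_rel. \<Sum>t\<in>c. inverse (real (class_size t)))"
    using sum_inverse_class_size by simp
  also have "\<dots> = (\<Sum>t\<in>?A. inverse (real (class_size t)))"
    by (rule sum_quotient_iso[OF fin]) (auto dest: tree_iso_size1)
  also have "\<dots> \<le> (\<Sum>t\<in>?A. real (class_size t) powi (-1) * x ^ size1 t / x ^ K)"
  proof (intro sum_mono)
    fix t assume t: "t \<in> ?A"
    have "x ^ K \<le> x ^ size1 t" using x t by (intro power_decreasing) auto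
    hence "1 \<le> x ^ size1 t / x ^ K" using x by simp
    hence "inverse (real (class_size t)) * 1 \<le> inverse (real (class_size t)) * (x ^ size1 t / x ^ K)"
      by (intro mult_left_mono) auto
    thus "inverse (real (class_size t)) \<le> real (class_size t) powi (-1) * x ^ size1 t / x ^ K"
      by simp
  qed
  also have "\<dots> \<le> (\<Sum>t\<in>bounded_height K. real (class_size t) powi (-1) * x ^ size1 t / x ^ K)"
    using x sub by (intro sum_mono2) auto
  also have "\<dots> = iso_sum (-1) x K / x ^ K"
    by (simp add: iso_sum_def sum_divide_distrib)
  also have "\<dots> \<le> B / x ^ K" using x bound by (intro divide_right_mono) auto
  finally show ?thesis .
qed

section \<open>Bounds for the number of classes in a single tree\<close>

lemma finite_subtrees: "finite (subtrees t)"
  by (induction t) auto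

lemma card_subtrees_le_occ: "card (subtrees t \<inter> A) \<le> occ A t"
proof (induction t)
  case (Node l u r)
  have "subtrees (Node l u r) \<inter> A = ({Node l u r} \<inter> A) \<union> (subtrees l \<inter> A) \<union> (subtrees r \<inter> A)"
    by auto
  also have "card \<dots> \<le> card ({Node l u r} \<inter> A) + card (subtrees l \<inter> A) + card (subtrees r \<inter> A)"
    by (meson add_le_mono card_Un_le le_refl order_trans)
  also have "card ({Node l u r} \<inter> A) = of_bool (Node l u r \<in> A)" by simp
  finally show ?case using Node by simp
qed auto

lemma num_fringe_classes_le:
  "num_fringe_classes t \<le> card ({s. size1 s < K} // tree_iso_rel) + occ {s. size1 s \<ge> K} t"
proof -
  have fin: "finite {t :: unit tree. size1 t < K}"
    by (rule finite_subset[OF size1_less_bounded_height]) simp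
  have "subtrees t // tree_iso_rel \<subseteq>
      {s. size1 s < K} // tree_iso_rel \<union> iso_class ` (subtrees t \<inter> {s. size1 s \<ge> K})"
  proof
    fix c assume "c \<in> subtrees t // tree_iso_rel"
    then obtain s where "s \<in> subtrees t" "c = iso_class s" by (auto simp: quotient_iso)
    thus "c \<in> {s. size1 s < K} // tree_iso_rel \<union> iso_class ` (subtrees t \<inter> {s. size1 s \<ge> K})"
      by (cases "size1 s < K") (simp_all add: quotient_iso)
  qed
  hence "num_fringe_classes t \<le> card ({s. size1 s < K} // tree_iso_rel \<union> iso_class ` (subtrees t \<inter> {s. size1 s \<ge> K}))"
    unfolding num_fringe_classes_def
    by (intro card_mono) (auto simp: quotient_iso finite_subtrees fin)
  also have "\<dots> \<le> card ({s. size1 s < K} // tree_iso_rel) + card (subtrees t \<inter> {s. size1 s \<ge> K})"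
    by (rule order_trans[OF card_Un_le]) (simp add: card_image_le finite_subtrees)
  finally show ?thesis using card_subtrees_le_occ[of t "{s. size1 s \<ge> K}"] by linarith
qed

lemma occ_Union_disjoint:
  assumes "finite C" and "\<And>c c'. c \<in> C \<Longrightarrow> c' \<in> C \<Longrightarrow> c \<noteq> c' \<Longrightarrow> c \<inter> c' = {}"
  shows "occ (\<Union>C) t = (\<Sum>c\<in>C. occ c t)"
  using assms
proof (induction C rule: finite_induct)
  case empty
  show ?case by (induction t) auto
next
  case (insert c C)
  have "c \<inter> \<Union>C = {}" using insert.prems insert.hyps by blast
  hence "occ (\<Union>(insert c C)) t = occ c t + occ (\<Union>C) t" by (simp add: occ_Un_disjoint)
  also have "occ (\<Union>C) t = (\<Sum>c\<in>C. occ c t)" using insert.prems by (intro insert.IH) auto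
  finally show ?case using insert.hyps by simp
qed

text \<open>A Bonferroni inequality: a class met m times contributes 1 if m > 0, which is at least m
  minus the number of unordered pairs among its m occurrences.\<close>

lemma num_fringe_classes_ge:
  assumes fin: "finite A" and closed: "\<And>s t. s \<in> A \<Longrightarrow> tree_iso s t \<Longrightarrow> t \<in> A"
  shows "real (num_fringe_classes t) \<ge> real (occ A t)
    - (\<Sum>c\<in>A // tree_iso_rel. real (occ c t) * (real (occ c t) - 1)) / 2"
proof -
  let ?C = "A // tree_iso_rel"
  have finC: "finite ?C" using fin by (simp add: quotient_iso)
  have "occ A t = occ (\<Union>?C) t" using Union_quotient_iso[of A] closed by simp
  also have "\<dots> = (\<Sum>c\<in>?C. occ c t)"
    by (rule occ_Union_disjoint[OF finC disjoint_quotient_iso])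
  finally have "real (occ A t) - (\<Sum>c\<in>?C. real (occ c t) * (real (occ c t) - 1)) / 2
     = (\<Sum>c\<in>?C. real (occ c t) - real (occ c t) * (real (occ c t) - 1) / 2)"
    by (simp add: sum_subtractf sum_divide_distrib)
  also have "\<dots> \<le> (\<Sum>c\<in>?C. of_bool (occ c t > 0))"
  proof (intro sum_mono)
    fix c
    \<comment> \<open>This uses that m is an integer: no integer lies strictly between 1 and
      2.\<close>
    have "(real m - 1) * (real m - 2) \<ge> 0" for m
      by (cases "m \<ge> 2") (auto intro: mult_nonpos_nonpos simp: not_le less_2_cases_iff)
    moreover have "m - m * (m - 1) / 2 = 1 - (m - 1) * (m - 2) / 2" for m :: real
      by (simp add: field_simps)
    ultimately have "real (occ c t) - real (occ c t) * (real (occ c t) - 1) / 2 \<le> 1"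
      by simp
    thus "real (occ c t) - real (occ c t) * (real (occ c t) - 1) / 2 \<le> of_bool (occ c t > 0)"
      by (cases "occ c t = 0") simp_all
  qed
  also have "\<dots> = real (card {c \<in> ?C. occ c t > 0})"
    using finC by (simp add: Int_def)
  also have "card {c \<in> ?C. occ c t > 0} \<le> num_fringe_classes t"
    unfolding num_fringe_classes_def
  proof (intro card_mono subsetI)
    fix c assume c: "c \<in> {c \<in> ?C. occ c t > 0}"
    then obtain s s' where s: "c = iso_class s" "s' \<in> subtrees t" "s' \<in> c"
      by (auto simp: quotient_iso occ_pos_iff)
    hence "c = iso_class s'" using iso_class_eq[of s s'] by simp
    with s show "c \<in> subtrees t // tree_iso_rel" by (auto simp: quotient_iso)
  qed (simp add: quotient_iso finite_subtrees)
  finally show ?thesis by simp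
qed

subsection \<open>Large and small fringe subtrees\<close>

lemma card_trees_with_leaves_le: "real (card (trees_with_leaves n)) \<le> 4 ^ n"
proof (cases "n = 0")
  case False
  then obtain m where m: "n = Suc m" by (cases n) auto
  have "central_ratio m \<le> central_ratio 0" by (intro central_ratio_antimono) simp
  hence "central m \<le> 4 ^ m" by (simp add: central_eq)
  moreover have "central m / real n \<le> central m / 1"
    using m by (intro divide_left_mono) (auto simp: less_imp_le)
  moreover have "(4 :: real) ^ m \<le> 4 ^ n" using m by simp
  ultimately have "central m / real n \<le> 4 ^ n" by linarith
  thus ?thesis using False by (simp add: card_trees_with_leaves m)
qed simp

text \<open>Catalan numbers divided by powers of 4 telescope. As K grows the value tends to 2, the
  number of nodes per leaf; K \<le> n + 1 keeps the truncation at n from cutting anything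
  off.\<close>

lemma fringe_density_small:
  assumes K: "K \<ge> 1" "K \<le> Suc n"
  shows "fringe_density {t. size1 t < K} n = 2 * (1 - central_ratio (K - 1))"
proof -
  have "4 * level_card {t. size1 t < K} j / 4 ^ j
      = (if j \<in> {1..<K} then 2 * (central_ratio (j - 1) - central_ratio j) else 0)" for j
  proof (cases "j \<in> {1..<K}")
    case True
    hence "level_card {t. size1 t < K} j = real (card (trees_with_leaves j))"
      unfolding level_card_def trees_with_leaves_def
      by (intro arg_cong[of _ _ "\<lambda>X. real (card X)"]) auto
    moreover obtain i where "j = Suc i" using True by (cases j) auto
    ultimately show ?thesis
      using True central_ratio_telescope[of i] by (simp add: card_trees_with_leaves central_eq)
  next
    case False
    hence "{t. size1 t < K} \<inter> trees_with_leaves j = {}"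
      by (auto simp: trees_with_leaves_def size1_size)
    hence "level_card {t. size1 t < K} j = 0" by (simp add: level_card_def)
    thus ?thesis using False by (simp only: if_False mult_zero_right div_0)
  qed
  hence "fringe_density {t. size1 t < K} n
      = (\<Sum>j=0..n. if j \<in> {1..<K} then 2 * (central_ratio (j - 1) - central_ratio j) else 0)"
    unfolding fringe_density_def by (intro sum.cong) auto
  also have "\<dots> = (\<Sum>j\<in>{0..n} \<inter> {1..<K}. 2 * (central_ratio (j - 1) - central_ratio j))"
    by (rule sum.inter_restrict[symmetric]) simp
  also have "{0..n} \<inter> {1..<K} = {1..<K}" using K by auto
  also have "(\<Sum>j\<in>{1..<K}. 2 * (central_ratio (j - 1) - central_ratio j))
      = (\<Sum>i<K-1. 2 * (central_ratio i - central_ratio (Suc i)))"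
    by (rule sum.reindex_bij_witness[of _ Suc "\<lambda>j. j - 1"]) auto
  also have "\<dots> = 2 * (1 - central_ratio (K - 1))"
    by (simp only: sum_distrib_left[symmetric] sum_lessThan_telescope' central_ratio_0)
  finally show ?thesis .
qed

lemma occ_large_eq:
  assumes "t \<in> trees_with_leaves n"
  shows "real (occ {s. size1 s \<ge> K} t) = 2 * real n - 1 - real (occ {s. size1 s < K} t)"
proof -
  have "occ UNIV t = occ ({s. size1 s < K} \<union> {s. size1 s \<ge> K}) t"
    by (intro arg_cong2[of _ _ _ _ occ]) auto
  also have "\<dots> = occ {s. size1 s < K} t + occ {s. size1 s \<ge> K} t"
    by (rule occ_Un_disjoint) auto
  finally show ?thesis using occ_UNIV[of t] assms by (simp add: trees_with_leaves_def)
qed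

lemma tree_E_occ_large:
  assumes n: "n \<ge> 1"
  shows "tree_E n (\<lambda>t. real (occ {s. size1 s \<ge> K} t))
    = 2 * real n - 1 - tree_E n (\<lambda>t. real (occ {s. size1 s < K} t))"
proof -
  have "tree_E n (\<lambda>t. real (occ {s. size1 s \<ge> K} t))
      = tree_E n (\<lambda>t. 2 * real n - 1 - real (occ {s. size1 s < K} t))"
    by (simp only: tree_E_eq[OF n] occ_large_eq cong: sum.cong)
  thus ?thesis using n by simp
qed

text \<open>By passing to the complement among all 2n - 1 nodes, the lower bound for the mean number
  of small fringe subtrees becomes an upper bound for the large ones.\<close>

lemma tree_E_occ_large_le:
  assumes n: "n \<ge> 1" and K: "K \<ge> 1"
  shows "tree_E n (\<lambda>t. real (occ {s. size1 s \<ge> K} t)) \<le> 2 * real n * central_ratio (K - 1)"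
proof (cases "K \<le> Suc n")
  case True
  show ?thesis
    using tree_E_occ_ge[OF n, of "{s. size1 s < K}"] fringe_density_small[OF K True]
    by (simp add: tree_E_occ_large[OF n] algebra_simps)
next
  case False
  have "occ {s. size1 s \<ge> K} t = 0" if "t \<in> trees_with_leaves n" for t
    using that False by (intro occ_eq_0) (auto simp: trees_with_leaves_def)
  hence "tree_E n (\<lambda>t. real (occ {s. size1 s \<ge> K} t)) = 0"
    using n by (simp add: tree_E_eq)
  thus ?thesis by (simp add: less_imp_le)
qed

text \<open>The mean is linear in the numbers of members of each size, so a proportion \<delta>
  within every size from K on carries over to the fringe subtrees.\<close>

lemma tree_E_occ_sub_large_le:
  assumes n: "n \<ge> 1" and K: "K \<ge> 1" and A: "\<And>t. t \<in> A \<Longrightarrow> size1 t \<ge> K" and \<delta>: "\<delta> \<ge> 0"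
    and rare: "\<And>j. j \<ge> K \<Longrightarrow> level_card A j \<le> \<delta> * real (card (trees_with_leaves j))"
  shows "tree_E n (\<lambda>t. real (occ A t)) \<le> \<delta> * (2 * real n * central_ratio (K - 1))"
proof -
  let ?L = "{s. size1 s \<ge> K}"
  have "(\<Sum>t\<in>trees_with_leaves n. real (occ A t)) \<le> (\<Sum>j=0..n. \<delta> * (level_card ?L j * central (n - j)))"
    unfolding sum_occ
  proof (intro sum_mono)
    fix j
    have "level_card A j \<le> \<delta> * level_card ?L j"
    proof (cases "j \<ge> K")
      case True
      hence "?L \<inter> trees_with_leaves j = trees_with_leaves j" by (auto simp: trees_with_leaves_def)
      thus ?thesis using rare[OF True] by (simp add: level_card_def)
    next
      case False
      hence "A \<inter> trees_with_leaves j = {}" using A by (force simp: trees_with_leaves_def)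
      thus ?thesis using \<delta> by (simp add: level_card_def)
    qed
    hence "level_card A j * central (n - j) \<le> (\<delta> * level_card ?L j) * central (n - j)"
      by (intro mult_right_mono) (auto simp: less_imp_le)
    thus "level_card A j * central (n - j) \<le> \<delta> * (level_card ?L j * central (n - j))"
      by (simp add: mult_ac)
  qed
  also have "\<dots> = \<delta> * (\<Sum>t\<in>trees_with_leaves n. real (occ ?L t))"
    by (simp add: sum_occ sum_distrib_left)
  finally have "tree_E n (\<lambda>t. real (occ A t)) \<le> \<delta> * tree_E n (\<lambda>t. real (occ ?L t))"
    using n by (simp add: tree_E_eq divide_right_mono)
  also have "\<dots> \<le> \<delta> * (2 * real n * central_ratio (K - 1))"
    by (intro mult_left_mono tree_E_occ_large_le n K \<delta>)
  finally show ?thesis .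
qed

section \<open>Probabilities, and thresholds of logarithmic size\<close>

lemma tree_P_eq:
  "n \<ge> 1 \<Longrightarrow> tree_P n A = level_card A n / real (card (trees_with_leaves n))"
  by (simp add: random_tree_def measure_pmf_of_set trees_with_leaves_nonempty
      finite_trees_with_leaves level_card_def Int_commute)

lemma tree_P_mono:
  assumes "n \<ge> 1" "\<And>t. t \<in> trees_with_leaves n \<Longrightarrow> t \<in> A \<Longrightarrow> t \<in> B"
  shows "tree_P n A \<le> tree_P n B"
  using assms unfolding tree_P_eq[OF assms(1)] level_card_def
  by (intro divide_right_mono of_nat_mono card_mono) (auto simp: finite_trees_with_leaves)

lemma tree_P_tendsto_1:
  assumes "(\<lambda>n. p n) \<longlonglongrightarrow> 0" "\<forall>\<^sub>F n in sequentially. tree_P n (- A n) \<le> p n"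
  shows "(\<lambda>n. tree_P n (A n)) \<longlonglongrightarrow> 1"
proof (rule tendsto_sandwich[where f = "\<lambda>n. 1 - p n" and h = "\<lambda>_. 1"])
  have "tree_P n (A n) = 1 - tree_P n (- A n)" for n
    using measure_pmf.prob_compl[of "A n" "random_tree n"] by (simp add: Compl_eq_Diff_UNIV)
  thus "\<forall>\<^sub>F n in sequentially. 1 - p n \<le> tree_P n (A n)"
    using assms(2) by (auto elim: eventually_mono)
  show "(\<lambda>n. 1 - p n) \<longlonglongrightarrow> 1" using tendsto_diff[OF tendsto_const[of 1] assms(1)] by simp
qed (auto intro: always_eventually)

abbreviation scale :: "nat \<Rightarrow> real" where
  "scale n \<equiv> real n / sqrt (ln (real n))"

text \<open>For a threshold K asymptotic to L ln n, the estimate 2n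
  \<open>central_ratio (K - 1)\<close> for the number of fringe subtrees with at least K leaves is
  asymptotically 2 / sqrt (pi L) times \<open>scale n\<close>.\<close>

lemma central_ratio_threshold:
  fixes K :: "nat \<Rightarrow> nat"
  assumes K: "(\<lambda>n. real (K n) / ln (real n)) \<longlonglongrightarrow> L" and L: "L > 0"
  shows "(\<lambda>n. central_ratio (K n - 1) * sqrt (ln (real n))) \<longlonglongrightarrow> 1 / sqrt (pi * L)"
    and "filterlim K at_top sequentially"
proof -
  have ln: "filterlim (\<lambda>n::nat. ln (real n)) at_top sequentially" by real_asymp
  have "filterlim (\<lambda>n. (real (K n) / ln (real n)) * ln (real n)) at_top sequentially"
    by (rule filterlim_tendsto_pos_mult_at_top[OF K L ln])
  moreover have "\<forall>\<^sub>F n in sequentially. (real (K n) / ln (real n)) * ln (real n) = real (K n)"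
    using eventually_gt_at_top[of 1] by eventually_elim simp
  ultimately have "filterlim (\<lambda>n. real (K n)) at_top sequentially"
    using filterlim_cong[OF refl refl] by fastforce
  thus Kinf: "filterlim K at_top sequentially"
    by (simp add: filterlim_sequentially_iff_filterlim_real)
  have "filterlim (\<lambda>n. K n - 1) at_top sequentially"
    using filterlim_compose[OF _ Kinf, of "\<lambda>k. k - 1" at_top] filterlim_minus_const_nat_at_top by blast
  hence 1: "(\<lambda>n. central_ratio (K n - 1) * sqrt (real (K n - 1))) \<longlonglongrightarrow> 1 / sqrt pi"
    by (rule filterlim_compose[OF central_ratio_asymp])
  have "(\<lambda>n. real (K n) / ln (real n) - 1 / ln (real n)) \<longlonglongrightarrow> L - 0"
    by (intro tendsto_diff K) real_asymp
  hence "(\<lambda>n. sqrt (real (K n) / ln (real n) - 1 / ln (real n))) \<longlonglongrightarrow> sqrt L"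
    by (intro tendsto_real_sqrt) simp
  hence 2: "(\<lambda>n. central_ratio (K n - 1) * sqrt (real (K n - 1)) / sqrt (real (K n) / ln (real n) - 1 / ln (real n)))
      \<longlonglongrightarrow> 1 / sqrt pi / sqrt L"
    using L by (intro tendsto_divide 1) auto
  have "\<forall>\<^sub>F n in sequentially. central_ratio (K n - 1) * sqrt (real (K n - 1)) / sqrt (real (K n) / ln (real n) - 1 / ln (real n))
     = central_ratio (K n - 1) * sqrt (ln (real n))"
    using eventually_gt_at_top[of 1] filterlim_at_top[THEN iffD1, OF Kinf, rule_format, of 2]
  proof eventually_elim
    case (elim n)
    have "real (K n) / ln (real n) - 1 / ln (real n) = real (K n - 1) / ln (real n)"
      using elim by (simp add: of_nat_diff diff_divide_distrib)
    hence "sqrt (real (K n) / ln (real n) - 1 / ln (real n)) = sqrt (real (K n - 1)) / sqrt (ln (real n))"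
      by (simp add: real_sqrt_divide)
    thus ?case using elim by simp
  qed
  from Lim_transform_eventually[OF 2 this]
  show "(\<lambda>n. central_ratio (K n - 1) * sqrt (ln (real n))) \<longlonglongrightarrow> 1 / sqrt (pi * L)"
    by (simp add: real_sqrt_mult)
qed

text \<open>The variance is O(n ln n), while the square of \<open>scale n\<close> is n^2 / ln n;
  Chebyshev's bound is of order (ln n)^2 / n.\<close>

lemma tree_P_small_deviation_tendsto_0:
  assumes K: "(\<lambda>n. real (K n) / ln (real n)) \<longlonglongrightarrow> L" and \<epsilon>: "\<epsilon> > 0"
  shows "(\<lambda>n. tree_P n {t. \<epsilon> * scale n \<le> \<bar>real (occ {s. size1 s < K n} t)
      - tree_E n (\<lambda>t. real (occ {s. size1 s < K n} t))\<bar>}) \<longlonglongrightarrow> 0"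
proof (rule tendsto_sandwich[where f = "\<lambda>_. 0" and
      h = "\<lambda>n. 8 / \<epsilon>\<^sup>2 * ((real (K n) / ln (real n)) * (ln (real n) ^ 2 / real n))"])
  have "(\<lambda>n::nat. ln (real n) ^ 2 / real n) \<longlonglongrightarrow> 0" by real_asymp
  hence "(\<lambda>n. 8 / \<epsilon>\<^sup>2 * ((real (K n) / ln (real n)) * (ln (real n) ^ 2 / real n))) \<longlonglongrightarrow> 8 / \<epsilon>\<^sup>2 * (L * 0)"
    by (intro tendsto_mult tendsto_const K)
  thus "(\<lambda>n. 8 / \<epsilon>\<^sup>2 * ((real (K n) / ln (real n)) * (ln (real n) ^ 2 / real n))) \<longlonglongrightarrow> 0" by simp
  show "\<forall>\<^sub>F n in sequentially. tree_P n {t. \<epsilon> * scale n \<le> \<bar>real (occ {s. size1 s < K n} t)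
      - tree_E n (\<lambda>t. real (occ {s. size1 s < K n} t))\<bar>}
      \<le> 8 / \<epsilon>\<^sup>2 * ((real (K n) / ln (real n)) * (ln (real n) ^ 2 / real n))"
    using eventually_gt_at_top[of 1]
  proof eventually_elim
    case (elim n)
    have ln: "ln (real n) > 0" using elim by simp
    have "tree_P n {t. \<epsilon> * scale n \<le> \<bar>real (occ {s. size1 s < K n} t)
      - tree_E n (\<lambda>t. real (occ {s. size1 s < K n} t))\<bar>} \<le> 8 * real (K n) * real n / (\<epsilon> * scale n)\<^sup>2"
      using elim \<epsilon> ln by (intro tree_P_occ_deviation) auto
    also have "(\<epsilon> * scale n)\<^sup>2 = \<epsilon>\<^sup>2 * real n ^ 2 / ln (real n)"
      using ln by (simp add: power_mult_distrib power_divide)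
    also have "8 * real (K n) * real n / (\<epsilon>\<^sup>2 * real n ^ 2 / ln (real n))
       = 8 / \<epsilon>\<^sup>2 * ((real (K n) / ln (real n)) * (ln (real n) ^ 2 / real n))"
      using ln elim \<epsilon> by (simp add: power2_eq_square field_simps)
    finally show ?case .
  qed
qed auto

subsection \<open>Upper bound\<close>

lemma upper_bound:
  assumes \<rho>: "0 < \<rho>" "\<rho> < 1" and bound: "\<And>d. iso_sum (-1) \<rho> d \<le> 1"
    and c: "c > 2 * sqrt (ln (1 / \<rho>) / pi)"
  shows "\<forall>\<^sub>F n in sequentially. tree_E n (\<lambda>t. real (num_fringe_classes t)) \<le> c * scale n"
    and "(\<lambda>n. tree_P n {t. real (num_fringe_classes t) \<le> c * scale n}) \<longlonglongrightarrow> 1"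
proof -
  define \<beta> where "\<beta> = ln (1 / \<rho>)"
  have \<beta>: "\<beta> > 0" using \<rho> by (simp add: \<beta>_def)
  \<comment> \<open>The largest threshold for which \<rho>^(-K) is at most n / ln n, which is
    negligible compared with \<open>scale n\<close>.\<close>
  define K where "K n = nat \<lfloor>ln (real n / ln (real n)) / \<beta>\<rfloor>" for n :: nat
  have KL: "(\<lambda>n. real (K n) / ln (real n)) \<longlonglongrightarrow> 1 / \<beta>"
  proof -
    have "(\<lambda>n. real (K n) / ln (real n)) \<longlonglongrightarrow> inverse \<beta>"
      unfolding K_def using \<beta> by real_asymp
    thus ?thesis by (simp add: inverse_eq_divide)
  qed
  note lim = central_ratio_threshold[OF KL]
  have lim_u: "(\<lambda>n. central_ratio (K n - 1) * sqrt (ln (real n))) \<longlonglongrightarrow> 1 / sqrt (pi * (1 / \<beta>))"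
    using lim(1) \<beta> by simp
  have K1: "\<forall>\<^sub>F n in sequentially. K n \<ge> 1"
    using lim(2) \<beta> by (simp add: filterlim_at_top)
  have Kn: "\<forall>\<^sub>F n in sequentially. K n \<le> n"
  proof -
    have "\<forall>\<^sub>F n in sequentially. real (K n) \<le> real n" unfolding K_def using \<beta> by real_asymp
    thus ?thesis by simp
  qed
  have \<rho>K: "\<forall>\<^sub>F n in sequentially. 1 / \<rho> ^ K n \<le> real n / ln (real n)"
  proof -
    have "\<forall>\<^sub>F n::nat in sequentially. ln (real n / ln (real n)) / \<beta> \<ge> 0" using \<beta> by real_asymp
    moreover have "\<forall>\<^sub>F n::nat in sequentially. ln (real n) > 0" by real_asymp
    ultimately show ?thesis using eventually_gt_at_top[of 1]
    proof eventually_elim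
      case (elim n)
      have "real (K n) \<le> ln (real n / ln (real n)) / \<beta>" using elim by (simp add: K_def)
      hence "real (K n) * \<beta> \<le> ln (real n / ln (real n))" using \<beta> by (simp add: field_simps)
      hence "exp (real (K n) * \<beta>) \<le> exp (ln (real n / ln (real n)))" by simp
      also have "\<dots> = real n / ln (real n)" using elim by simp
      also have "exp (real (K n) * \<beta>) = (1 / \<rho>) ^ K n"
        using \<rho> by (simp add: \<beta>_def exp_of_nat_mult)
      finally show ?case by (simp add: power_one_over)
    qed
  qed
  define b where "b n = real n / ln (real n) + 2 * real n * central_ratio (K n - 1)" for n
  have lim_b: "(\<lambda>n. b n / scale n) \<longlonglongrightarrow> 2 * sqrt (\<beta> / pi)"
  proof -
    have "(\<lambda>n::nat. 1 / sqrt (ln (real n))) \<longlonglongrightarrow> 0" by real_asymp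
    hence "(\<lambda>n. 1 / sqrt (ln (real n)) + 2 * (central_ratio (K n - 1) * sqrt (ln (real n))))
        \<longlonglongrightarrow> 0 + 2 * (1 / sqrt (pi * (1 / \<beta>)))"
      by (intro tendsto_add tendsto_mult tendsto_const lim_u)
    moreover have "\<forall>\<^sub>F n in sequentially. 1 / sqrt (ln (real n)) + 2 * (central_ratio (K n - 1) * sqrt (ln (real n))) = b n / scale n"
      using eventually_gt_at_top[of 1]
    proof eventually_elim
      case (elim n)
      define q where "q = sqrt (ln (real n))"
      have "ln (real n) = q * q" "q > 0" using elim by (simp_all add: q_def)
      thus ?case using elim by (simp add: b_def field_simps)
    qed
    ultimately have "(\<lambda>n. b n / scale n) \<longlonglongrightarrow> 0 + 2 * (1 / sqrt (pi * (1 / \<beta>)))"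
      by (rule Lim_transform_eventually)
    thus ?thesis using \<beta> by (simp add: real_sqrt_divide)
  qed
  define \<epsilon> where "\<epsilon> = (c - 2 * sqrt (\<beta> / pi)) / 2"
  have \<epsilon>: "\<epsilon> > 0" using c by (simp add: \<epsilon>_def \<beta>_def)
  have scale_pos: "\<forall>\<^sub>F n::nat in sequentially. scale n > 0" by real_asymp
  have "2 * sqrt (\<beta> / pi) < c - \<epsilon>" proof -
    have "s < c - (c - s) / 2" if "0 < (c - s) / 2" for s :: real using that by argo
    thus ?thesis using \<epsilon> unfolding \<epsilon>_def by blast
  qed
  from order_tendstoD(2)[OF lim_b this] scale_pos
  have b_le: "\<forall>\<^sub>F n in sequentially. b n \<le> (c - \<epsilon>) * scale n"
    by eventually_elim (simp only: pos_divide_less_eq less_imp_le)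
  have F_le: "\<forall>\<^sub>F n in sequentially. \<forall>t. real (num_fringe_classes t)
      \<le> real n / ln (real n) + real (occ {s. size1 s \<ge> K n} t)"
    using \<rho>K
  proof (eventually_elim, intro allI)
    fix n t assume le: "1 / \<rho> ^ K n \<le> real n / ln (real n)"
    have "real (num_fringe_classes t) \<le> real (card ({s. size1 s < K n} // tree_iso_rel))
        + real (occ {s. size1 s \<ge> K n} t)"
      using num_fringe_classes_le[of t "K n"] by linarith
    also have "real (card ({s. size1 s < K n} // tree_iso_rel)) \<le> 1 / \<rho> ^ K n"
      using \<rho> bound by (intro card_small_classes_le) auto
    finally show "real (num_fringe_classes t) \<le> real n / ln (real n) + real (occ {s. size1 s \<ge> K n} t)"
      using le by linarith
  qed
  show "\<forall>\<^sub>F n in sequentially. tree_E n (\<lambda>t. real (num_fringe_classes t)) \<le> c * scale n"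
    using F_le b_le K1 eventually_ge_at_top[of 1] scale_pos
  proof eventually_elim
    case (elim n)
    have "tree_E n (\<lambda>t. real (num_fringe_classes t))
        \<le> tree_E n (\<lambda>t. real n / ln (real n) + real (occ {s. size1 s \<ge> K n} t))"
      using elim by (intro tree_E_mono) auto
    also have "\<dots> = real n / ln (real n) + tree_E n (\<lambda>t. real (occ {s. size1 s \<ge> K n} t))"
      using elim by simp
    also have "\<dots> \<le> b n"
      unfolding b_def using elim by (intro add_left_mono tree_E_occ_large_le)
    also have "\<dots> \<le> (c - \<epsilon>) * scale n" by (rule elim)
    also have "\<dots> \<le> c * scale n" using \<epsilon> elim by (intro mult_right_mono) auto
    finally show ?case .
  qed
  show "(\<lambda>n. tree_P n {t. real (num_fringe_classes t) \<le> c * scale n}) \<longlonglongrightarrow> 1"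
  proof (rule tree_P_tendsto_1[OF tree_P_small_deviation_tendsto_0[OF KL \<epsilon>]])
    show "\<forall>\<^sub>F n in sequentially. tree_P n (- {t. real (num_fringe_classes t) \<le> c * scale n})
      \<le> tree_P n {t. \<epsilon> * scale n \<le> \<bar>real (occ {s. size1 s < K n} t)
        - tree_E n (\<lambda>t. real (occ {s. size1 s < K n} t))\<bar>}"
      using F_le b_le K1 Kn eventually_ge_at_top[of 1]
    proof eventually_elim
      case (elim n)
      show ?case
      proof (rule tree_P_mono)
        \<comment> \<open>Too many classes force too many large fringe subtrees, that is, a number
          of small ones at least \<epsilon> \<open>scale n\<close> below its mean.\<close>
        fix t assume t: "t \<in> trees_with_leaves n" "t \<in> - {t. real (num_fringe_classes t) \<le> c * scale n}"
        have "c * scale n < real n / ln (real n) + real (occ {s. size1 s \<ge> K n} t)"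
          using t elim(1) by (force simp: not_le intro: less_le_trans)
        also have "real (occ {s. size1 s \<ge> K n} t) = 2 * real n - 1 - real (occ {s. size1 s < K n} t)"
          by (rule occ_large_eq[OF t(1)])
        finally have "c * scale n < real n / ln (real n) + (2 * real n - 1 - real (occ {s. size1 s < K n} t))" .
        moreover have "tree_E n (\<lambda>t. real (occ {s. size1 s < K n} t)) \<ge> real n * (2 * (1 - central_ratio (K n - 1)))"
          using tree_E_occ_ge[of n "{s. size1 s < K n}"] fringe_density_small[of "K n" n] elim by simp
        moreover have "b n \<le> c * scale n - \<epsilon> * scale n" using elim(2) by (simp only: left_diff_distrib)
        ultimately show "t \<in> {t. \<epsilon> * scale n \<le> \<bar>real (occ {s. size1 s < K n} t)
            - tree_E n (\<lambda>t. real (occ {s. size1 s < K n} t))\<bar>}"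
          by (simp add: b_def algebra_simps)
      qed (use elim in simp)
    qed
  qed
qed

subsection \<open>Lower bound\<close>

text \<open>Only nodes whose children have height at most d are taken, so that the set is finite and
  its members have bounded size, as the variance bound requires.\<close>

definition symmetric_nodes :: "nat \<Rightarrow> unit tree set" where
  "symmetric_nodes d = {Node l u r | l u r. l \<in> bounded_height d \<and> tree_iso l r}"

lemma symmetric_nodes_eq:
  "symmetric_nodes d = (\<lambda>(l, r). Node l () r) ` (SIGMA l:bounded_height d. iso_class l)"
  by (auto simp: symmetric_nodes_def)

lemma finite_symmetric_nodes: "finite (symmetric_nodes d)"
  unfolding symmetric_nodes_eq by auto

lemma fringe_density_finite:
  assumes "finite A" "\<And>t. t \<in> A \<Longrightarrow> size1 t \<le> n"
  shows "fringe_density A n = (\<Sum>t\<in>A. 4 / 4 ^ size1 t)"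
proof -
  have "(\<Sum>t\<in>A. 4 / 4 ^ size1 t) = (\<Sum>j=0..n. \<Sum>t\<in>{t \<in> A. size1 t = j}. 4 / 4 ^ size1 t :: real)"
    using assms by (subst sum.group[where T = "{0..n}"]) auto
  also have "\<dots> = (\<Sum>j=0..n. 4 * level_card A j / 4 ^ j)"
    by (intro sum.cong refl) (simp add: level_card_def trees_with_leaves_def Int_def)
  finally show ?thesis by (simp add: fringe_density_def)
qed

text \<open>A left child with k leaves has as many possible right children as its class has members,
  and each resulting tree of size 2k has weight 4 / 16^k.\<close>

lemma fringe_density_symmetric_nodes:
  assumes "\<And>t. t \<in> symmetric_nodes d \<Longrightarrow> size1 t \<le> n"
  shows "fringe_density (symmetric_nodes d) n = 4 * iso_sum 1 (1 / 16) d"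
proof -
  have inj: "inj_on (\<lambda>(l, r). Node l () r) X" for X by (auto simp: inj_on_def)
  have "fringe_density (symmetric_nodes d) n = (\<Sum>t\<in>symmetric_nodes d. 4 / 4 ^ size1 t)"
    by (rule fringe_density_finite[OF finite_symmetric_nodes assms])
  also have "\<dots> = (\<Sum>l\<in>bounded_height d. \<Sum>r\<in>iso_class l. 4 / 4 ^ (size1 l + size1 r))"
    unfolding symmetric_nodes_eq by (subst sum.reindex[OF inj]) (simp add: sum.Sigma split_def)
  also have "\<dots> = (\<Sum>l\<in>bounded_height d. \<Sum>r\<in>iso_class l. 4 / 16 ^ size1 l)"
  proof (intro sum.cong refl)
    fix l r assume "r \<in> iso_class l"
    hence "size1 r = size1 l" using tree_iso_size1[of l r] by simp
    moreover have "(16 :: real) ^ size1 l = 4 ^ size1 l * 4 ^ size1 l"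
      by (simp flip: power_mult_distrib)
    ultimately show "4 / 4 ^ (size1 l + size1 r) = (4 / 16 ^ size1 l :: real)"
      by (simp add: power_add)
  qed
  also have "\<dots> = 4 * iso_sum 1 (1 / 16) d"
    by (simp add: iso_sum_def card_iso_class sum_distrib_left power_one_over mult_ac)
  finally show ?thesis .
qed

text \<open>The exceptional trees, with fewer than \<nu> k symmetric nodes among k leaves. Stated
  through the class size, the condition is visibly invariant under isomorphism.\<close>

definition large_class :: "real \<Rightarrow> unit tree set" where
  "large_class \<nu> = {t. real (class_size t) > 2 powr ((1 - \<nu>) * real (size1 t))}"

text \<open>A member has fewer than \<nu> n symmetric nodes, although those of bounded height alone
  have mean at least \<alpha> n with \<alpha> > \<nu> and variance O(n). Chebyshev's inequality
  gives O(1/n).\<close>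

lemma large_class_rare:
  assumes \<nu>: "\<nu> < 4 * iso_sum 1 (1 / 16) d"
  shows "(\<lambda>n. tree_P n (large_class \<nu>)) \<longlonglongrightarrow> 0"
proof -
  let ?A = "symmetric_nodes d"
  define \<alpha> where "\<alpha> = 4 * iso_sum 1 (1 / 16) d"
  obtain M where M: "\<And>t. t \<in> ?A \<Longrightarrow> size1 t \<le> M"
    using finite_imageI[OF finite_symmetric_nodes, of size1 d, THEN finite_nat_set_iff_bounded_le[THEN iffD1]]
    by auto
  show ?thesis
  proof (rule tendsto_sandwich[where f = "\<lambda>_. 0" and h = "\<lambda>n. 8 * real M * real n / ((\<alpha> - \<nu>) * real n)\<^sup>2"])
    show "\<forall>\<^sub>F n in sequentially. tree_P n (large_class \<nu>) \<le> 8 * real M * real n / ((\<alpha> - \<nu>) * real n)\<^sup>2"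
      using eventually_ge_at_top[of "M + 1"]
    proof eventually_elim
      case (elim n)
      have n: "n \<ge> 1" using elim by simp
      have mean: "real n * \<alpha> \<le> tree_E n (\<lambda>t. real (occ ?A t))"
        using tree_E_occ_ge[OF n, of ?A] fringe_density_symmetric_nodes[of d n] M elim
        by (force simp: \<alpha>_def)
      have "tree_P n (large_class \<nu>)
          \<le> tree_P n {t. (\<alpha> - \<nu>) * real n \<le> \<bar>real (occ ?A t) - tree_E n (\<lambda>t. real (occ ?A t))\<bar>}"
      proof (rule tree_P_mono[OF n])
        fix t assume t: "t \<in> trees_with_leaves n" "t \<in> large_class \<nu>"
        let ?S = "{Node l u r | l u r. tree_iso l r}"
        have "real (class_size t) * 2 ^ occ ?S t = 2 ^ size t"
          using arg_cong[OF class_size_symmetric_nodes, of real t] by simp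
        also have "\<dots> \<le> (2 :: real) ^ n"
          using t by (intro power_increasing) (auto simp: trees_with_leaves_def size1_size)
        also have "\<dots> = 2 powr real n" by (simp add: powr_realpow)
        finally have "real (class_size t) * 2 powr real (occ ?S t) \<le> 2 powr real n"
          by (simp only: powr_realpow zero_less_numeral)
        moreover have "2 powr ((1 - \<nu>) * real n) * 2 powr real (occ ?S t) < real (class_size t) * 2 powr real (occ ?S t)"
          using t by (intro mult_strict_right_mono) (auto simp: large_class_def trees_with_leaves_def)
        ultimately have "2 powr ((1 - \<nu>) * real n + real (occ ?S t)) < 2 powr real n"
          unfolding powr_add by linarith
        hence "real (occ ?S t) < \<nu> * real n" by (simp add: algebra_simps)
        moreover have "occ ?A t \<le> occ ?S t"
          by (rule occ_mono) (auto simp: symmetric_nodes_def)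
        ultimately show "t \<in> {t. (\<alpha> - \<nu>) * real n \<le> \<bar>real (occ ?A t) - tree_E n (\<lambda>t. real (occ ?A t))\<bar>}"
          using mean by (simp add: algebra_simps)
      qed
      also have "\<dots> \<le> 8 * real M * real n / ((\<alpha> - \<nu>) * real n)\<^sup>2"
        using \<nu> elim M by (intro tree_P_occ_deviation n) (auto simp: \<alpha>_def)
      finally show ?case .
    qed
    show "(\<lambda>n. 8 * real M * real n / ((\<alpha> - \<nu>) * real n)\<^sup>2) \<longlonglongrightarrow> 0"
    proof -
      have "\<alpha> - \<nu> > 0" using \<nu> by (simp add: \<alpha>_def)
      moreover have "(\<lambda>n. 8 * m * real n / (a * real n)\<^sup>2) \<longlonglongrightarrow> 0" if "a > 0" for a m :: real
        using that by real_asymp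
      ultimately show ?thesis by blast
    qed
  qed auto
qed

lemma sum_geometric_le:
  fixes r :: real
  assumes "0 \<le> r" "r \<le> 1 / 2"
  shows "(\<Sum>k=K..n. r ^ k) \<le> 2 * r ^ K"
proof (cases "K \<le> n")
  case True
  have "(\<Sum>k=K..n. r ^ k) \<le> (\<Sum>k=K..n. 2 * (r ^ k - r ^ Suc k))"
  proof (intro sum_mono)
    fix k
    have "r * r ^ k \<le> 1 / 2 * r ^ k" using assms by (intro mult_right_mono) auto
    thus "r ^ k \<le> 2 * (r ^ k - r ^ Suc k)" by simp
  qed
  also have "\<dots> = 2 * (\<Sum>k=K..n. r ^ k - r ^ Suc k)" by (rule sum_distrib_left[symmetric])
  also have "(\<Sum>k=K..n. r ^ k - r ^ Suc k) = r ^ K - r ^ Suc n"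
    using sum_Suc_diff[of K n "\<lambda>k. - (r ^ k)"] True by simp
  also have "2 * (r ^ K - r ^ Suc n) \<le> 2 * r ^ K" using assms by simp
  finally show ?thesis .
qed (use assms in simp)

text \<open>A class of m trees with k leaves yields at most 16 n^2 m^2 / 16^k expected ordered
  pairs. The sum of m^2 over classes is the sum of class sizes over trees, here at most 4^k 2^((1 -
  \<nu>) k). The result is a geometric series of ratio 2^(-(1 + \<nu>)) \<le> 1/2.\<close>

lemma tree_E_isomorphic_pairs_le:
  assumes n: "n \<ge> 1" and \<nu>: "\<nu> \<ge> 0"
    and A: "A = {t. K \<le> size1 t \<and> size1 t \<le> n} - large_class \<nu>"
  shows "tree_E n (\<lambda>t. \<Sum>c\<in>A // tree_iso_rel. real (occ c t) * (real (occ c t) - 1))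
    \<le> 32 * real n ^ 2 * (2 powr (- (1 + \<nu>))) ^ K"
proof -
  define r where "r = 2 powr (- (1 + \<nu>))"
  have "r \<le> 2 powr (- 1)" unfolding r_def using \<nu> by (intro powr_mono) auto
  hence r: "0 \<le> r" "r \<le> 1 / 2" by (auto simp: r_def powr_minus)
  have closed: "t \<in> A" if "s \<in> A" "tree_iso s t" for s t
    using that tree_iso_size1[of s t] tree_iso_class_size[of s t] by (auto simp: A large_class_def)
  have sub: "A \<subseteq> {t. size1 t < Suc n}" by (auto simp: A)
  have fin: "finite A"
    using finite_subset[OF sub] finite_subset[OF size1_less_bounded_height, of "Suc n"] by simp
  have "tree_E n (\<lambda>t. \<Sum>c\<in>A // tree_iso_rel. real (occ c t) * (real (occ c t) - 1))
      = (\<Sum>c\<in>A // tree_iso_rel. tree_E n (\<lambda>t. real (occ c t) * (real (occ c t) - 1)))"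
    using n by (intro Bochner_Integration.integral_sum) simp
  also have "\<dots> \<le> (\<Sum>c\<in>A // tree_iso_rel. \<Sum>t\<in>c. 16 * real n ^ 2 * (real (class_size t) / 16 ^ size1 t))"
  proof (intro sum_mono)
    fix c assume c: "c \<in> A // tree_iso_rel"
    then obtain s where s: "c = iso_class s" by (auto simp: quotient_iso)
    have size: "size1 t = size1 s" if "t \<in> c" for t
      using that tree_iso_size1[of s t] by (simp add: s)
    have "(4 :: real) ^ size1 s * 4 ^ size1 s = 16 ^ size1 s" by (simp flip: power_mult_distrib)
    hence "(real n * (4 * real (card c) / 4 ^ size1 s)) ^ 2
        = 16 * real n ^ 2 * (real (card c) ^ 2 / 16 ^ size1 s)"
      by (simp add: power2_eq_square)
    also have "\<dots> = 16 * real n ^ 2 * ((\<Sum>t\<in>c. real (class_size t)) / 16 ^ size1 s)"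
      using sum_inverse_class_size(2)[OF c] by simp
    also have "\<dots> = (\<Sum>t\<in>c. 16 * real n ^ 2 * (real (class_size t) / 16 ^ size1 s))"
      by (simp add: sum_distrib_left sum_divide_distrib)
    also have "\<dots> = (\<Sum>t\<in>c. 16 * real n ^ 2 * (real (class_size t) / 16 ^ size1 t))"
      by (intro sum.cong refl) (simp add: size)
    finally have eq: "(real n * (4 * real (card c) / 4 ^ size1 s)) ^ 2
        = (\<Sum>t\<in>c. 16 * real n ^ 2 * (real (class_size t) / 16 ^ size1 t))" .
    show "tree_E n (\<lambda>t. real (occ c t) * (real (occ c t) - 1))
        \<le> (\<Sum>t\<in>c. 16 * real n ^ 2 * (real (class_size t) / 16 ^ size1 t))"
      unfolding eq[symmetric] by (rule tree_E_occ_pairs_le[OF n size])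
  qed
  also have "\<dots> = (\<Sum>t\<in>A. 16 * real n ^ 2 * (real (class_size t) / 16 ^ size1 t))"
    by (rule sum_quotient_iso[OF fin closed])
  also have "\<dots> \<le> (\<Sum>t\<in>A. 16 * real n ^ 2 * (2 powr ((1 - \<nu>) * real (size1 t)) / 16 ^ size1 t))"
    by (intro sum_mono mult_left_mono divide_right_mono) (auto simp: A large_class_def)
  also have "\<dots> \<le> (\<Sum>t\<in>(\<Union>k\<in>{K..n}. trees_with_leaves k).
      16 * real n ^ 2 * (2 powr ((1 - \<nu>) * real (size1 t)) / 16 ^ size1 t))"
    by (intro sum_mono2) (auto simp: A trees_with_leaves_def intro: finite_trees_with_leaves[unfolded trees_with_leaves_def])
  also have "\<dots> = (\<Sum>k=K..n. \<Sum>t\<in>trees_with_leaves k.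
      16 * real n ^ 2 * (2 powr ((1 - \<nu>) * real (size1 t)) / 16 ^ size1 t))"
    by (intro sum.UNION_disjoint) (auto simp: finite_trees_with_leaves, auto simp: trees_with_leaves_def)
  also have "\<dots> \<le> (\<Sum>k=K..n. 16 * real n ^ 2 * r ^ k)"
  proof (intro sum_mono)
    fix k
    have rk: "4 ^ k * (2 powr ((1 - \<nu>) * real k) / 16 ^ k) = r ^ k"
    proof -
      have "r ^ k = 2 powr (- (1 + \<nu>) * real k)"
        by (simp add: r_def powr_powr flip: powr_realpow)
      also have "\<dots> = 2 powr (2 * real k + (1 - \<nu>) * real k - 4 * real k)"
        by (simp add: algebra_simps)
      also have "\<dots> = (2 powr 2) powr real k * 2 powr ((1 - \<nu>) * real k) / (2 powr 4) powr real k"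
        unfolding powr_diff powr_add powr_powr ..
      also have "\<dots> = 4 ^ k * (2 powr ((1 - \<nu>) * real k) / 16 ^ k)"
        by (simp add: powr_realpow)
      finally show ?thesis by simp
    qed
    have "(\<Sum>t\<in>trees_with_leaves k. 16 * real n ^ 2 * (2 powr ((1 - \<nu>) * real (size1 t)) / 16 ^ size1 t))
       = (\<Sum>t\<in>trees_with_leaves k. 16 * real n ^ 2 * (2 powr ((1 - \<nu>) * real k) / 16 ^ k))"
      by (intro sum.cong refl) (simp add: trees_with_leaves_def)
    also have "\<dots> = real (card (trees_with_leaves k)) * (16 * real n ^ 2 * (2 powr ((1 - \<nu>) * real k) / 16 ^ k))"
      by simp
    also have "\<dots> \<le> 4 ^ k * (16 * real n ^ 2 * (2 powr ((1 - \<nu>) * real k) / 16 ^ k))"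
      by (intro mult_right_mono card_trees_with_leaves_le) auto
    also have "\<dots> = 16 * real n ^ 2 * r ^ k" unfolding rk[symmetric] by simp
    finally show "(\<Sum>t\<in>trees_with_leaves k. 16 * real n ^ 2 * (2 powr ((1 - \<nu>) * real (size1 t)) / 16 ^ size1 t))
       \<le> 16 * real n ^ 2 * r ^ k" .
  qed
  also have "\<dots> = 16 * real n ^ 2 * (\<Sum>k=K..n. r ^ k)" by (simp add: sum_distrib_left)
  also have "\<dots> \<le> 16 * real n ^ 2 * (2 * r ^ K)"
    by (intro mult_left_mono sum_geometric_le r) auto
  finally show ?thesis by (simp add: r_def)
qed

text \<open>The cut at n leaves makes A finite and loses nothing, since a tree with n leaves has no
  larger fringe subtree.\<close>

lemma num_fringe_classes_ge_large:
  assumes n: "t \<in> trees_with_leaves n"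
    and A: "A = {t. K \<le> size1 t \<and> size1 t \<le> n} - large_class \<nu>"
  shows "real (num_fringe_classes t) \<ge> real (occ {s. size1 s \<ge> K} t)
    - real (occ ({s. size1 s \<ge> K} \<inter> large_class \<nu>) t)
    - (\<Sum>c\<in>A // tree_iso_rel. real (occ c t) * (real (occ c t) - 1)) / 2"
proof -
  let ?B = "{s. size1 s \<ge> K} \<inter> large_class \<nu>"
  let ?C = "{s. K \<le> size1 s \<and> n < size1 s} - large_class \<nu>"
  have closed: "t \<in> A" if "s \<in> A" "tree_iso s t" for s t
    using that tree_iso_size1[of s t] tree_iso_class_size[of s t] by (auto simp: A large_class_def)
  have sub: "A \<subseteq> {t. size1 t < Suc n}" by (auto simp: A)
  have fin: "finite A"
    using finite_subset[OF sub] finite_subset[OF size1_less_bounded_height, of "Suc n"] by simp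
  have "occ {s. size1 s \<ge> K} t = occ ((A \<union> ?B) \<union> ?C) t"
    by (intro arg_cong2[of _ _ _ _ occ]) (auto simp: A)
  also have "\<dots> = occ A t + occ ?B t + occ ?C t"
    by (subst occ_Un_disjoint, force simp: A, subst occ_Un_disjoint, force simp: A) simp
  also have "occ ?C t = 0"
    using n by (intro occ_eq_0) (auto simp: trees_with_leaves_def)
  finally have "occ {s. size1 s \<ge> K} t = occ A t + occ ?B t" by simp
  moreover have "real (num_fringe_classes t) \<ge> real (occ A t)
      - (\<Sum>c\<in>A // tree_iso_rel. real (occ c t) * (real (occ c t) - 1)) / 2"
    by (rule num_fringe_classes_ge[OF fin closed])
  ultimately show ?thesis by simp
qed

lemma lower_bound:
  assumes \<nu>: "0 \<le> \<nu>" "\<nu> < 4 * iso_sum 1 (1 / 16) d"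
    and c: "c < 2 * sqrt ((1 + \<nu>) * ln 2 / pi)"
  shows "(\<lambda>n. tree_P n {t. c * scale n \<le> real (num_fringe_classes t)}) \<longlonglongrightarrow> 1"
proof -
  define \<gamma> where "\<gamma> = (1 + \<nu>) * ln 2"
  have \<gamma>: "\<gamma> > 0" using \<nu> by (simp add: \<gamma>_def)
  \<comment> \<open>The smallest threshold with 2^((1 + \<nu>) K) \<ge> n ln n; the isomorphic pairs
    then number O(n / ln n) in the mean.\<close>
  define K where "K n = nat \<lceil>ln (real n * ln (real n)) / \<gamma>\<rceil>" for n :: nat
  have KL: "(\<lambda>n. real (K n) / ln (real n)) \<longlonglongrightarrow> 1 / \<gamma>"
  proof -
    have "(\<lambda>n. real (K n) / ln (real n)) \<longlonglongrightarrow> inverse \<gamma>"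
      unfolding K_def using \<gamma> by real_asymp
    thus ?thesis by (simp add: inverse_eq_divide)
  qed
  have lim_u: "(\<lambda>n. central_ratio (K n - 1) * sqrt (ln (real n))) \<longlonglongrightarrow> 1 / sqrt (pi * (1 / \<gamma>))"
    and Kinf: "filterlim K at_top sequentially"
    using central_ratio_threshold[OF KL] \<gamma> by simp_all
  have K1: "\<forall>\<^sub>F n in sequentially. K n \<ge> 1"
    using Kinf by (simp add: filterlim_at_top)
  \<comment> \<open>The factor 2 keeps the denominator of \<open>q\<close> at least n.\<close>
  have Kn: "\<forall>\<^sub>F n in sequentially. 2 * K n \<le> n"
  proof -
    have "\<forall>\<^sub>F n in sequentially. 2 * real (K n) \<le> real n" unfolding K_def using \<gamma> by real_asymp
    thus ?thesis by (rule eventually_mono) linarith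
  qed
  have scale_pos: "\<forall>\<^sub>F n::nat in sequentially. scale n > 0" by real_asymp
  \<comment> \<open>\<open>q\<close> is the correction factor of the upper bound for the small
    fringe subtrees, and \<open>b\<close> the resulting lower bound for the mean number of large
    ones. Since \<open>b\<close> subtracts terms of order n, \<open>q - 1\<close> must be small even
    after multiplication by sqrt (ln n).\<close>
  define q where "q n = (2 * real n - 1) / (2 * real (n - K n) + 1)" for n
  define b where "b n = 2 * real n - 1 - real n * (2 * (1 - central_ratio (K n - 1))) * q n" for n
  have lim_q: "(\<lambda>n. sqrt (ln (real n)) * (q n - 1)) \<longlonglongrightarrow> 0"
  proof (rule tendsto_sandwich[where f = "\<lambda>_. 0" and
        h = "\<lambda>n. 2 * ((real (K n) / ln (real n)) * (ln (real n) * sqrt (ln (real n)) / real n))"])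
    have "(\<lambda>n::nat. ln (real n) * sqrt (ln (real n)) / real n) \<longlonglongrightarrow> 0" by real_asymp
    hence "(\<lambda>n. 2 * ((real (K n) / ln (real n)) * (ln (real n) * sqrt (ln (real n)) / real n)))
        \<longlonglongrightarrow> 2 * (1 / \<gamma> * 0)"
      by (intro tendsto_mult tendsto_const KL)
    thus "(\<lambda>n. 2 * ((real (K n) / ln (real n)) * (ln (real n) * sqrt (ln (real n)) / real n))) \<longlonglongrightarrow> 0"
      by simp
    have q_bounds: "0 \<le> q n - 1 \<and> q n - 1 \<le> 2 * real (K n) / real n"
      if "1 \<le> K n" "2 * K n \<le> n" for n
    proof -
      have D: "2 * real (n - K n) + 1 = 2 * real n - 2 * real (K n) + 1"
        using that by (simp add: of_nat_diff)
      have "q n - 1 = (2 * real (K n) - 2) / (2 * real n - 2 * real (K n) + 1)"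
        unfolding q_def D using that by (simp add: field_simps)
      moreover have "(2 * real (K n) - 2) / (2 * real n - 2 * real (K n) + 1) \<le> 2 * real (K n) / real n"
        using that by (intro frac_le) auto
      ultimately show ?thesis using that by auto
    qed
    show "\<forall>\<^sub>F n in sequentially. 0 \<le> sqrt (ln (real n)) * (q n - 1)"
      using K1 Kn eventually_gt_at_top[of 1]
    proof eventually_elim
      case (elim n)
      thus ?case using q_bounds[of n] by (intro mult_nonneg_nonneg) auto
    qed
    show "\<forall>\<^sub>F n in sequentially. sqrt (ln (real n)) * (q n - 1)
        \<le> 2 * ((real (K n) / ln (real n)) * (ln (real n) * sqrt (ln (real n)) / real n))"
      using K1 Kn eventually_gt_at_top[of 1]
    proof eventually_elim
      case (elim n)
      have "sqrt (ln (real n)) * (q n - 1) \<le> sqrt (ln (real n)) * (2 * real (K n) / real n)"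
        using q_bounds[of n] elim by (intro mult_left_mono) auto
      also have "\<dots> = 2 * ((real (K n) / ln (real n)) * (ln (real n) * sqrt (ln (real n)) / real n))"
        using elim by simp
      finally show ?case .
    qed
  qed auto
  have lim_b: "(\<lambda>n. b n / scale n) \<longlonglongrightarrow> 2 * sqrt (\<gamma> / pi)"
  proof -
    have u0: "(\<lambda>n. central_ratio (K n - 1)) \<longlonglongrightarrow> 0"
    proof -
      have "(\<lambda>n::nat. 1 / sqrt (ln (real n))) \<longlonglongrightarrow> 0" by real_asymp
      from tendsto_mult[OF lim_u this]
      have "(\<lambda>n. central_ratio (K n - 1) * sqrt (ln (real n)) * (1 / sqrt (ln (real n)))) \<longlonglongrightarrow> 0"
        by simp
      moreover have "\<forall>\<^sub>F n in sequentially. central_ratio (K n - 1) * sqrt (ln (real n)) * (1 / sqrt (ln (real n)))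
          = central_ratio (K n - 1)"
        using eventually_gt_at_top[of 1] by eventually_elim simp
      ultimately show ?thesis by (rule Lim_transform_eventually)
    qed
    have "(\<lambda>n::nat. sqrt (ln (real n)) / real n) \<longlonglongrightarrow> 0" by real_asymp
    hence "(\<lambda>n. 2 * (central_ratio (K n - 1) * sqrt (ln (real n)))
        - 2 * (1 - central_ratio (K n - 1)) * (sqrt (ln (real n)) * (q n - 1)) - sqrt (ln (real n)) / real n)
        \<longlonglongrightarrow> 2 * (1 / sqrt (pi * (1 / \<gamma>))) - 2 * (1 - 0) * 0 - 0"
      by (intro tendsto_diff tendsto_mult tendsto_const lim_u lim_q u0)
    moreover have "\<forall>\<^sub>F n in sequentially. 2 * (central_ratio (K n - 1) * sqrt (ln (real n)))
        - 2 * (1 - central_ratio (K n - 1)) * (sqrt (ln (real n)) * (q n - 1)) - sqrt (ln (real n)) / real n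
        = b n / scale n"
      using eventually_gt_at_top[of 1]
    proof eventually_elim
      case (elim n)
      define s where "s = sqrt (ln (real n))"
      have "s > 0" using elim by (simp add: s_def)
      thus ?case using elim unfolding b_def s_def[symmetric] by (simp add: field_simps)
    qed
    ultimately have "(\<lambda>n. b n / scale n) \<longlonglongrightarrow> 2 * (1 / sqrt (pi * (1 / \<gamma>))) - 2 * (1 - 0) * 0 - 0"
      by (rule Lim_transform_eventually)
    thus ?thesis using \<gamma> by (simp add: real_sqrt_divide)
  qed
  \<comment> \<open>A quarter of the gap: three error terms use at most \<epsilon>
    \<open>scale n\<close> each, and the last quarter absorbs the convergence of
    \<open>b\<close>.\<close>
  define \<epsilon> where "\<epsilon> = (2 * sqrt (\<gamma> / pi) - c) / 4"
  have \<epsilon>: "\<epsilon> > 0" using c by (simp add: \<epsilon>_def \<gamma>_def)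
  have "c + 3 * \<epsilon> < 2 * sqrt (\<gamma> / pi)"
  proof -
    have "c + 3 * ((s - c) / 4) < s" if "0 < (s - c) / 4" for s :: real using that by argo
    thus ?thesis using \<epsilon> unfolding \<epsilon>_def by blast
  qed
  from order_tendstoD(1)[OF lim_b this] scale_pos
  have b_ge: "\<forall>\<^sub>F n in sequentially. (c + 3 * \<epsilon>) * scale n \<le> b n"
    by eventually_elim (simp only: pos_less_divide_eq less_imp_le)
  define small where "small n = (\<lambda>t. real (occ {s. size1 s < K n} t))" for n
  define large where "large n = (\<lambda>t. real (occ ({s. size1 s \<ge> K n} \<inter> large_class \<nu>) t))" for n
  define A where "A n = {t. K n \<le> size1 t \<and> size1 t \<le> n} - large_class \<nu>" for n
  define pairs where "pairs n = (\<lambda>t. \<Sum>c\<in>A n // tree_iso_rel. real (occ c t) * (real (occ c t) - 1))" for n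
  have lim_small: "(\<lambda>n. tree_P n {t. \<epsilon> * scale n \<le> \<bar>small n t - tree_E n (small n)\<bar>}) \<longlonglongrightarrow> 0"
    unfolding small_def by (rule tree_P_small_deviation_tendsto_0[OF KL \<epsilon>])
  have lim_large: "(\<lambda>n. tree_E n (large n) / (\<epsilon> * scale n)) \<longlonglongrightarrow> 0"
  proof (rule LIMSEQ_I)
    fix r :: real assume r: "r > 0"
    define B where "B = 1 / sqrt (pi * (1 / \<gamma>)) + 1"
    have "sqrt (pi * (1 / \<gamma>)) > 0" using \<gamma> by simp
    hence B: "B > 0" unfolding B_def by (intro add_nonneg_pos) auto
    \<comment> \<open>At most 2B \<open>scale n\<close> large fringe subtrees are expected, of which
      a proportion \<delta> is exceptional; this choice makes the product half of r \<epsilon>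
      \<open>scale n\<close>.\<close>
    define \<delta> where "\<delta> = r * \<epsilon> / (4 * B)"
    have \<delta>: "\<delta> > 0" using r \<epsilon> B by (simp add: \<delta>_def)
    have "\<forall>\<^sub>F n in sequentially. tree_P n (large_class \<nu>) < \<delta>"
      using large_class_rare[OF \<nu>(2)] \<delta> by (rule order_tendstoD(2))
    then obtain N where N: "\<And>n. n \<ge> N \<Longrightarrow> tree_P n (large_class \<nu>) < \<delta>"
      by (auto simp: eventually_sequentially)
    have "\<forall>\<^sub>F n in sequentially. K n \<ge> N" using Kinf by (simp add: filterlim_at_top)
    moreover have "\<forall>\<^sub>F n in sequentially. central_ratio (K n - 1) * sqrt (ln (real n)) < B"
      by (rule order_tendstoD(2)[OF lim_u]) (simp add: B_def)
    ultimately have "\<forall>\<^sub>F n in sequentially. norm (tree_E n (large n) / (\<epsilon> * scale n) - 0) < r"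
      using K1 eventually_gt_at_top[of 1] scale_pos
    proof eventually_elim
      case (elim n)
      have "tree_E n (large n) \<le> \<delta> * (2 * real n * central_ratio (K n - 1))"
        unfolding large_def
      proof (rule tree_E_occ_sub_large_le)
        fix j assume j: "K n \<le> j"
        have "level_card ({s. K n \<le> size1 s} \<inter> large_class \<nu>) j \<le> level_card (large_class \<nu>) j"
          unfolding level_card_def
          by (intro of_nat_mono card_mono) (auto simp: finite_trees_with_leaves)
        also have "\<dots> = tree_P j (large_class \<nu>) * real (card (trees_with_leaves j))"
          using j elim card_trees_pos[of j] by (simp add: tree_P_eq)
        also have "\<dots> \<le> \<delta> * real (card (trees_with_leaves j))"
          using j elim N[of j] by (intro mult_right_mono) auto
        finally show "level_card ({s. K n \<le> size1 s} \<inter> large_class \<nu>) j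
          \<le> \<delta> * real (card (trees_with_leaves j))" .
      qed (use elim \<delta> in auto)
      also have "\<dots> = 2 * \<delta> * (central_ratio (K n - 1) * sqrt (ln (real n))) * scale n"
        using elim by simp
      also have "\<dots> \<le> 2 * \<delta> * B * scale n"
        using elim \<delta> by (intro mult_right_mono mult_left_mono) auto
      also have "\<dots> = (r / 2) * (\<epsilon> * scale n)"
        using B by (simp add: \<delta>_def)
      also have "\<dots> < r * (\<epsilon> * scale n)"
        using r \<epsilon> elim by (intro mult_strict_right_mono mult_pos_pos) auto
      finally have "tree_E n (large n) < r * (\<epsilon> * scale n)" .
      moreover have "\<epsilon> * scale n > 0" using \<epsilon> elim by (intro mult_pos_pos) auto
      ultimately have "tree_E n (large n) / (\<epsilon> * scale n) < r"
        by (simp only: pos_divide_less_eq)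
      moreover have "tree_E n (large n) / (\<epsilon> * scale n) \<ge> 0"
        using elim \<epsilon> by (intro divide_nonneg_nonneg integral_nonneg_AE mult_nonneg_nonneg) (auto simp: large_def)
      ultimately show ?case by simp
    qed
    thus "\<exists>n0. \<forall>n\<ge>n0. norm (tree_E n (large n) / (\<epsilon> * scale n) - 0) < r"
      by (simp add: eventually_sequentially)
  qed
  have pairs_nonneg: "pairs n t \<ge> 0" for n t
  proof -
    have "real m * (real m - 1) \<ge> 0" for m by (cases m) auto
    thus ?thesis unfolding pairs_def by (intro sum_nonneg)
  qed
  have pairs_le: "\<forall>\<^sub>F n in sequentially. tree_E n (pairs n) \<le> 32 * real n / ln (real n)"
    using eventually_gt_at_top[of 1]
  proof eventually_elim
    case (elim n)
    have ln: "ln (real n) > 0" using elim by simp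
    have "ln (real n * ln (real n)) / \<gamma> \<le> real (K n)"
      unfolding K_def by linarith
    hence "ln (real n * ln (real n)) \<le> real (K n) * \<gamma>" using \<gamma> by (simp add: field_simps)
    hence "exp (ln (real n * ln (real n))) \<le> exp (real (K n) * \<gamma>)" by simp
    hence "real n * ln (real n) \<le> exp (real (K n) * \<gamma>)" using ln elim by simp
    moreover have "(2 powr (- (1 + \<nu>))) ^ K n = 1 / exp (real (K n) * \<gamma>)"
      by (simp add: powr_def \<gamma>_def exp_of_nat_mult[symmetric] exp_minus[symmetric] inverse_eq_divide[symmetric] algebra_simps)
    moreover have "1 / exp (real (K n) * \<gamma>) \<le> 1 / (real n * ln (real n))"
      using calculation(1) ln elim by (intro divide_left_mono) auto
    ultimately have "(2 powr (- (1 + \<nu>))) ^ K n \<le> 1 / (real n * ln (real n))" by simp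
    hence "32 * real n ^ 2 * (2 powr (- (1 + \<nu>))) ^ K n \<le> 32 * real n ^ 2 * (1 / (real n * ln (real n)))"
      by (intro mult_left_mono) auto
    also have "\<dots> = 32 * real n / ln (real n)" using elim by (simp add: power2_eq_square)
    finally show ?case
      using tree_E_isomorphic_pairs_le[of n \<nu> "A n" "K n"] elim \<nu> unfolding pairs_def A_def by simp
  qed
  have lim_pairs: "(\<lambda>n. tree_E n (pairs n) / (\<epsilon> * scale n)) \<longlonglongrightarrow> 0"
  proof (rule tendsto_sandwich[where f = "\<lambda>_. 0" and h = "\<lambda>n. (32 * real n / ln (real n)) / (\<epsilon> * scale n)"])
    show "\<forall>\<^sub>F n in sequentially. 0 \<le> tree_E n (pairs n) / (\<epsilon> * scale n)"
      using scale_pos eventually_gt_at_top[of 1]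
      by eventually_elim (use \<epsilon> in \<open>intro divide_nonneg_nonneg integral_nonneg_AE mult_nonneg_nonneg\<close>;
          simp add: pairs_nonneg)
    show "\<forall>\<^sub>F n in sequentially. tree_E n (pairs n) / (\<epsilon> * scale n) \<le> (32 * real n / ln (real n)) / (\<epsilon> * scale n)"
      using scale_pos pairs_le
    proof eventually_elim
      case (elim n)
      hence "\<epsilon> * scale n > 0" using \<epsilon> by (intro mult_pos_pos)
      with elim show ?case by (intro divide_right_mono) auto
    qed
    show "(\<lambda>n. (32 * real n / ln (real n)) / (\<epsilon> * scale n)) \<longlonglongrightarrow> 0"
      using \<epsilon> by real_asymp
  qed auto
  show ?thesis
  proof (rule tree_P_tendsto_1)
    show "(\<lambda>n. tree_P n {t. \<epsilon> * scale n \<le> \<bar>small n t - tree_E n (small n)\<bar>}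
        + tree_E n (large n) / (\<epsilon> * scale n) + tree_E n (pairs n) / (\<epsilon> * scale n)) \<longlonglongrightarrow> 0"
      using tendsto_add[OF tendsto_add[OF lim_small lim_large] lim_pairs] by simp
    show "\<forall>\<^sub>F n in sequentially. tree_P n (- {t. c * scale n \<le> real (num_fringe_classes t)})
      \<le> tree_P n {t. \<epsilon> * scale n \<le> \<bar>small n t - tree_E n (small n)\<bar>}
        + tree_E n (large n) / (\<epsilon> * scale n) + tree_E n (pairs n) / (\<epsilon> * scale n)"
      using b_ge K1 Kn scale_pos eventually_gt_at_top[of 1]
    proof eventually_elim
      case (elim n)
      have n: "n \<ge> 1" using elim by simp
      have pos: "\<epsilon> * scale n > 0" using \<epsilon> elim by (intro mult_pos_pos) auto
      let ?S = "{t. \<epsilon> * scale n \<le> \<bar>small n t - tree_E n (small n)\<bar>}"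
      let ?L = "{t. \<epsilon> * scale n \<le> large n t}" and ?Q = "{t. \<epsilon> * scale n \<le> pairs n t}"
      have mean: "tree_E n (small n) \<le> real n * (2 * (1 - central_ratio (K n - 1))) * q n"
        using tree_E_occ_le[OF n, of "{s. size1 s < K n}" "K n"] fringe_density_small[of "K n" n] elim
        unfolding small_def q_def by simp
      have "tree_P n (- {t. c * scale n \<le> real (num_fringe_classes t)}) \<le> tree_P n (?S \<union> ?L \<union> ?Q)"
      proof (rule tree_P_mono[OF n], rule ccontr)
        fix t assume t: "t \<in> trees_with_leaves n"
          "t \<in> - {t. c * scale n \<le> real (num_fringe_classes t)}" "t \<notin> ?S \<union> ?L \<union> ?Q"
        have "real (num_fringe_classes t) \<ge> real (occ {s. size1 s \<ge> K n} t) - large n t - pairs n t / 2"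
          using num_fringe_classes_ge_large[OF t(1) A_def] by (simp add: large_def pairs_def)
        moreover have "real (occ {s. size1 s \<ge> K n} t) = 2 * real n - 1 - small n t"
          using occ_large_eq[OF t(1)] by (simp add: small_def)
        moreover have "small n t < tree_E n (small n) + \<epsilon> * scale n" "large n t < \<epsilon> * scale n"
          "pairs n t < \<epsilon> * scale n"
          using t(3) by auto
        moreover have "real (num_fringe_classes t) < c * scale n" using t(2) by auto
        moreover have "c * scale n + 3 * (\<epsilon> * scale n) \<le> b n"
          using elim(1) by (simp only: distrib_right mult.assoc)
        ultimately show False using mean pos pairs_nonneg[of n t] unfolding b_def by linarith
      qed
      also have "\<dots> \<le> tree_P n ?S + tree_P n ?L + tree_P n ?Q"
        by (rule order_trans[OF measure_Un_le add_right_mono[OF measure_Un_le]]) auto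
      also have "\<dots> \<le> tree_P n ?S + tree_E n (large n) / (\<epsilon> * scale n) + tree_E n (pairs n) / (\<epsilon> * scale n)"
        by (intro add_mono tree_P_Markov n pos order.refl pairs_nonneg) (simp add: large_def)
      finally show ?case .
    qed
  qed
qed

subsection \<open>Numerical bounds\<close>

text \<open>The recursion in d is a monotone iteration started at x, so it stays below every
  supersolution s of its fixed point equation.\<close>

lemma iso_sum_classes_le:
  assumes x: "x \<ge> 0" and s: "x + s ^ 2 / 2 + s' / 2 \<le> s" and s': "\<And>d. iso_sum (-1) (x ^ 2) d \<le> s'"
  shows "iso_sum (-1) x d \<le> s"
proof (induction d)
  case 0
  have "s' \<ge> 0" using order_trans[OF zero_le_power2 s'[of 0, unfolded iso_sum_0]] .
  hence "x \<le> x + s ^ 2 / 2 + s' / 2" by simp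
  with s show ?case by simp
next
  case (Suc d)
  have "iso_sum (-1) x d ^ 2 \<le> s ^ 2"
    using Suc x by (intro power_mono iso_sum_nonneg)
  with s'[of d] s show ?case unfolding iso_sum_Suc by (simp add: power_int_minus)
qed

text \<open>A crude bound that ends the descent x, x^2, x^4, and so on: the term at x^2 is bounded
  by the one at x, and 9 x^2 \<le> x closes the induction.\<close>

lemma iso_sum_classes_le_triple:
  assumes x: "0 \<le> x" "x \<le> 1 / 9"
  shows "iso_sum (-1) x d \<le> 3 * x"
proof (induction d)
  case 0
  show ?case using x by simp
next
  case (Suc d)
  have "iso_sum (-1) (x ^ 2) d \<le> iso_sum (-1) x d"
    unfolding iso_sum_def
  proof (intro sum_mono mult_left_mono)
    fix t
    have "x ^ 2 \<le> x" using x by (simp add: power2_eq_square mult_left_le)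
    thus "(x ^ 2) ^ size1 t \<le> x ^ size1 t" using x by (intro power_mono) auto
  qed simp
  moreover have "iso_sum (-1) x d ^ 2 \<le> (3 * x) ^ 2"
    using Suc x by (intro power_mono iso_sum_nonneg) auto
  moreover have "9 * (x * x) \<le> x" using x mult_right_mono[of "9 * x" 1 x] by simp
  ultimately show ?case using Suc unfolding iso_sum_Suc
    by (simp add: power_int_minus power2_eq_square)
qed

lemma iso_sum_classes_step:
  assumes "\<And>y d. 0 \<le> y \<Longrightarrow> y \<le> b' \<Longrightarrow> iso_sum (-1) y d \<le> s'"
    and "b ^ 2 \<le> b'" "b + s ^ 2 / 2 + s' / 2 \<le> s" "0 \<le> x" "x \<le> b"
  shows "iso_sum (-1) x d \<le> s"
proof (rule iso_sum_classes_le)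
  have "x ^ 2 \<le> b ^ 2" using assms by (intro power_mono) auto
  from order_trans[OF this assms(2)] show "iso_sum (-1) (x ^ 2) d \<le> s'" for d
    by (intro assms(1)) simp_all
qed (use assms in auto)

text \<open>The singularity is at \<open>\<rho> = 0.402697503671\<dots>\<close>, where the value is 1. The rational numbers bound
  the arguments \<open>x, x\<^sup>2, x\<^sup>4, \<dots>\<close> from above and the values there by the rounded-up smaller root of
  \<open>s = b + s\<^sup>2/2 + s'/2\<close>, starting from the last one.\<close>

lemma iso_sum_classes_le_1: "iso_sum (-1) (40269750365 / 10 ^ 11) d \<le> 1"
proof -
  have s5: "iso_sum (-1) y d \<le> (3430972647 / 5000000000000000000000)" if "0 \<le> y" "y \<le> (1143657549 / 5000000000000000000000)" for y d
    using iso_sum_classes_le_triple[of y d] that by simp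
  have s4: "iso_sum (-1) y d \<le> (478259288823 / 1000000000000000000)" if "0 \<le> y" "y \<le> (1195647078397939 / 2500000000000000000000)" for y d
    by (rule iso_sum_classes_step[where b' = "(1143657549 / 5000000000000000000000)" and s' = "(3430972647 / 5000000000000000000000)", OF s5 _ _ that]) (simp_all add: power2_eq_square)
  have s3: "iso_sum (-1) y d \<le> (346020595667843 / 500000000000000000)" if "0 \<le> y" "y \<le> (6915626011860210323 / 10000000000000000000000)" for y d
    by (rule iso_sum_classes_step[where b' = "(1195647078397939 / 2500000000000000000000)" and s' = "(478259288823 / 1000000000000000000)", OF s4 _ _ that]) (simp_all add: power2_eq_square)
  have s2: "iso_sum (-1) y d \<le> (27008323214888159 / 1000000000000000000)" if "0 \<le> y" "y \<le> (16435986161112738833 / 625000000000000000000)" for y d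
    by (rule iso_sum_classes_step[where b' = "(6915626011860210323 / 10000000000000000000000)" and s' = "(346020595667843 / 500000000000000000)", OF s3 _ _ that]) (simp_all add: power2_eq_square)
  have s1: "iso_sum (-1) y d \<le> (38920998526408997 / 200000000000000000)" if "0 \<le> y" "y \<le> (64866111778376705329 / 400000000000000000000)" for y d
    by (rule iso_sum_classes_step[where b' = "(16435986161112738833 / 625000000000000000000)" and s' = "(27008323214888159 / 1000000000000000000)", OF s2 _ _ that]) (simp_all add: power2_eq_square)
  have s0: "iso_sum (-1) y d \<le> 1" if "0 \<le> y" "y \<le> (8053950073 / 20000000000)" for y d
    by (rule iso_sum_classes_step[where b' = "(64866111778376705329 / 400000000000000000000)" and s' = "(38920998526408997 / 200000000000000000)", OF s1 _ _ that]) (simp_all add: power2_eq_square)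
  show ?thesis by (rule s0) simp_all
qed

lemma iso_sum_Suc_odd:
  "iso_sum 1 x (Suc d) = x + 2 * iso_sum 1 x d ^ 2 - iso_sum 3 (x ^ 2) d"
  "iso_sum 3 x (Suc d) = x + 8 * iso_sum 3 x d ^ 2 - 7 * iso_sum 7 (x ^ 2) d"
  "iso_sum 7 x (Suc d) = x + 128 * iso_sum 7 x d ^ 2 - 127 * iso_sum 15 (x ^ 2) d"
  by (simp_all add: iso_sum_Suc)

text \<open>For e \<ge> 0 the correction for isomorphic children is nonpositive; dropping it leaves
  a monotone iteration below a supersolution.\<close>

lemma iso_sum_le_fixpoint:
  assumes "x \<ge> 0" "e \<ge> 0" "x + 2 powi e * s ^ 2 \<le> s"
  shows "iso_sum e x d \<le> s"
proof (induction d)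
  case 0
  have "0 \<le> (2 :: real) powi e * s ^ 2" by simp
  hence "x \<le> s" using assms by linarith
  thus ?case by simp
next
  case (Suc d)
  have "(2 :: real) powi e \<ge> 1" using assms by (intro one_le_power_int) auto
  hence "(1 - (2 :: real) powi e) * iso_sum (2 * e + 1) (x ^ 2) d \<le> 0"
    by (intro mult_nonpos_nonneg iso_sum_nonneg) auto
  moreover have "2 powi e * iso_sum e x d ^ 2 \<le> 2 powi e * s ^ 2"
    using Suc assms by (intro mult_left_mono power_mono iso_sum_nonneg) auto
  ultimately show ?case using assms unfolding iso_sum_Suc by linarith
qed

lemma iso_sum_convergent:
  assumes "x \<ge> 0" "\<And>d. iso_sum e x d \<le> s"
  obtains L where "iso_sum e x \<longlonglongrightarrow> L" "\<And>d. iso_sum e x d \<le> L" "L \<le> s"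
proof -
  have inc: "incseq (iso_sum e x)" using assms by (auto simp: incseq_def intro: iso_sum_mono)
  obtain L where L: "iso_sum e x \<longlonglongrightarrow> L" "\<And>d. iso_sum e x d \<le> L"
    using incseq_convergent[OF inc, of s] assms by blast
  moreover have "L \<le> s" using assms L by (intro LIMSEQ_le_const2) auto
  ultimately show ?thesis using that by blast
qed

text \<open>Shows that v - a v^2 is increasing as long as a (v + l) < 1, that is, on the branch of
  the smaller root.\<close>

lemma quadratic_diff: "(v - l) * (1 - a * (v + l)) = (v - a * v ^ 2) - (l - a * l ^ 2)"
  for a l v :: real
  by (simp add: algebra_simps power2_eq_square)

text \<open>Each limit solves a quadratic equation involving the next one; monotonicity of the relevant
  branch turns bounds for one into bounds for the other.\<close>

lemma iso_sum_one_large: "\<exists>d. (6776042339987 / 100000000000000) < iso_sum 1 (1/16) d"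
proof -
  \<comment> \<open>Just above the smaller root of s = x + 2^15 s^2. The next three bounds are
    simply 2x; they place the limits on the correct branch.\<close>
  have b15: "iso_sum 15 ((1/65536) ^ 2) d \<le> (46566484013 / 200000000000000000000)" for d
    by (rule iso_sum_le_fixpoint) (simp_all add: power2_eq_square)
  have b7: "iso_sum 7 ((1/256) ^ 2) d \<le> 1/32768" for d
    by (rule iso_sum_le_fixpoint) (simp_all add: power2_eq_square)
  have b3: "iso_sum 3 ((1/16) ^ 2) d \<le> 1/128" for d
    by (rule iso_sum_le_fixpoint) (simp_all add: power2_eq_square)
  have b1: "iso_sum 1 (1/16) d \<le> 1/8" for d
    by (rule iso_sum_le_fixpoint) (simp_all add: power2_eq_square)
  obtain L7 where L7: "iso_sum 7 ((1/256) ^ 2) \<longlonglongrightarrow> L7" "L7 \<le> 1/32768"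
    using iso_sum_convergent[OF _ b7] by auto
  obtain L3 where L3: "iso_sum 3 ((1/16) ^ 2) \<longlonglongrightarrow> L3" "L3 \<le> 1/128"
    using iso_sum_convergent[OF _ b3] by auto
  obtain L1 where L1: "iso_sum 1 (1/16) \<longlonglongrightarrow> L1" "L1 \<le> 1/8"
    using iso_sum_convergent[OF _ b1] by auto
  \<comment> \<open>The correction terms enter with a negative sign, so the direction alternates:
    upper bound for exponent 15, lower for 7, upper for 3, lower for 1.\<close>
  have L7_ge: "L7 \<ge> (1525902257972307 / 100000000000000000000)"
  proof -
    have "(\<lambda>d. 1/65536 + 128 * iso_sum 7 ((1/256) ^ 2) d ^ 2 - 127 * (46566484013 / 200000000000000000000)) \<longlonglongrightarrow> 1/65536 + 128 * L7 ^ 2 - 127 * (46566484013 / 200000000000000000000)"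
      by (intro tendsto_intros L7)
    moreover have "iso_sum 7 ((1/256) ^ 2) (Suc d) \<ge> 1/65536 + 128 * iso_sum 7 ((1/256) ^ 2) d ^ 2 - 127 * (46566484013 / 200000000000000000000)" for d
      using b15[of d] by (simp add: iso_sum_Suc_odd power2_eq_square)
    ultimately have "1/65536 + 128 * L7 ^ 2 - 127 * (46566484013 / 200000000000000000000) \<le> L7"
      using LIMSEQ_Suc[OF L7(1)] by (intro LIMSEQ_le) auto
    hence *: "1/65536 - 127 * (46566484013 / 200000000000000000000) \<le> L7 - 128 * L7 ^ 2" by linarith
    show ?thesis
    proof (rule ccontr)
      assume "\<not> ?thesis"
      hence "((1525902257972307 / 100000000000000000000) - L7) * (1 - 128 * ((1525902257972307 / 100000000000000000000) + L7)) > 0"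
        using L7(2) by (intro mult_pos_pos) auto
      hence "L7 - 128 * L7 ^ 2 < (1525902257972307 / 100000000000000000000) - 128 * (1525902257972307 / 100000000000000000000) ^ 2"
        unfolding quadratic_diff by (simp only: diff_gt_0_iff_gt diff_ge_0_iff_ge)
      with * show False by (simp add: power2_eq_square)
    qed
  qed
  have L3_le: "L3 \<le> (392252655877639 / 100000000000000000)"
  proof -
    have "(\<lambda>d. 1/256 + 8 * iso_sum 3 ((1/16) ^ 2) d ^ 2 - 7 * iso_sum 7 ((1/256) ^ 2) d) \<longlonglongrightarrow> 1/256 + 8 * L3 ^ 2 - 7 * L7"
      by (intro tendsto_intros L7 L3)
    moreover have "(\<lambda>d. 1/256 + 8 * iso_sum 3 ((1/16) ^ 2) d ^ 2 - 7 * iso_sum 7 ((1/256) ^ 2) d)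
        = (\<lambda>d. iso_sum 3 ((1/16) ^ 2) (Suc d))"
      by (simp add: iso_sum_Suc_odd power2_eq_square)
    ultimately have "L3 = 1/256 + 8 * L3 ^ 2 - 7 * L7"
      using LIMSEQ_Suc[OF L3(1)] LIMSEQ_unique by metis
    hence *: "L3 - 8 * L3 ^ 2 \<le> 1/256 - 7 * (1525902257972307 / 100000000000000000000)" using L7_ge by linarith
    show ?thesis
    proof (rule ccontr)
      assume "\<not> ?thesis"
      hence "(L3 - (392252655877639 / 100000000000000000)) * (1 - 8 * (L3 + (392252655877639 / 100000000000000000))) > 0"
        using L3(2) by (intro mult_pos_pos) auto
      hence "(392252655877639 / 100000000000000000) - 8 * (392252655877639 / 100000000000000000) ^ 2 < L3 - 8 * L3 ^ 2"
        unfolding quadratic_diff by (simp only: diff_gt_0_iff_gt diff_ge_0_iff_ge)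
      with * show False by (simp add: power2_eq_square)
    qed
  qed
  have "L1 > (6776042339987 / 100000000000000)"
  proof -
    have "(\<lambda>d. 1/16 + 2 * iso_sum 1 (1/16) d ^ 2 - iso_sum 3 ((1/16) ^ 2) d) \<longlonglongrightarrow> 1/16 + 2 * L1 ^ 2 - L3"
      by (intro tendsto_intros L1 L3)
    moreover have "(\<lambda>d. 1/16 + 2 * iso_sum 1 (1/16) d ^ 2 - iso_sum 3 ((1/16) ^ 2) d)
        = (\<lambda>d. iso_sum 1 (1/16) (Suc d))"
      by (simp add: iso_sum_Suc_odd power2_eq_square)
    ultimately have "L1 = 1/16 + 2 * L1 ^ 2 - L3"
      using LIMSEQ_Suc[OF L1(1)] LIMSEQ_unique by metis
    hence *: "L1 - 2 * L1 ^ 2 \<ge> 1/16 - (392252655877639 / 100000000000000000)" using L3_le by linarith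
    show ?thesis
    proof (rule ccontr)
      assume "\<not> ?thesis"
      hence "((6776042339987 / 100000000000000) - L1) * (1 - 2 * ((6776042339987 / 100000000000000) + L1)) \<ge> 0"
        using L1(2) by (intro mult_nonneg_nonneg) auto
      hence "L1 - 2 * L1 ^ 2 \<le> (6776042339987 / 100000000000000) - 2 * (6776042339987 / 100000000000000) ^ 2"
        unfolding quadratic_diff by (simp only: diff_gt_0_iff_gt diff_ge_0_iff_ge)
      with * show False by (simp add: power2_eq_square)
    qed
  qed
  hence "\<forall>\<^sub>F d in sequentially. iso_sum 1 (1/16) d > (6776042339987 / 100000000000000)"
    by (rule order_tendstoD(1)[OF L1(1)])
  thus ?thesis by (auto simp: eventually_sequentially)
qed

section \<open>Rational bounds for pi, logarithms and the two constants\<close>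

lemma arctan_series_bounds:
  assumes "0 \<le> x" "x \<le> (1::real)"
  shows "(\<Sum>k<2*n. (-1)^k * (1 / real (k*2+1) * x ^ (k*2+1))) \<le> arctan x"
    and "arctan x \<le> (\<Sum>k<2*n+1. (-1)^k * (1 / real (k*2+1) * x ^ (k*2+1)))"
proof -
  have x: "\<bar>x\<bar> \<le> 1" using assms by simp
  note mono = monoseq_arctan_series[OF x]
  have a: "decseq (\<lambda>n. 1 / real (n*2+1) * x ^ (n*2+1))"
  proof (rule decseq_SucI)
    fix n
    show "1 / real (Suc n * 2 + 1) * x ^ (Suc n * 2 + 1) \<le> 1 / real (n * 2 + 1) * x ^ (n * 2 + 1)"
      using assms by (intro mult_mono power_decreasing frac_le) auto
  qed
  hence dec: "1 / real (Suc n*2+1) * x ^ (Suc n*2+1) \<le> 1 / real (n*2+1) * x ^ (n*2+1)" for n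
    by (simp only: decseq_Suc_iff)
  note lim = zeroseq_arctan_series[OF x]
  have "(\<Sum>k. (-1)^k * (1 / real (k*2+1) * x ^ (k*2+1))) = arctan x"
    using arctan_series[OF x] by simp
  with summable_Leibniz'(2,4)[OF lim _ dec, of n] assms
  show "(\<Sum>k<2*n. (-1)^k * (1 / real (k*2+1) * x ^ (k*2+1))) \<le> arctan x"
    "arctan x \<le> (\<Sum>k<2*n+1. (-1)^k * (1 / real (k*2+1) * x ^ (k*2+1)))"
    by simp_all
qed

lemma pi_bounds: "3.14159265358979 < pi" "pi < 3.14159265358980"
proof -
  have "pi = 16 * arctan (1/5) - 4 * arctan (1/239)" using machin by simp
  moreover have "arctan (1/5) \<le> (\<Sum>k<2*5+1. (-1)^k * (1 / real (k*2+1) * (1/5) ^ (k*2+1)))"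
    "(\<Sum>k<2*6. (-1)^k * (1 / real (k*2+1) * (1/5) ^ (k*2+1))) \<le> arctan (1/5)"
    by (rule arctan_series_bounds; simp)+
  moreover have "arctan (1/239) \<le> (\<Sum>k<2*1+1. (-1)^k * (1 / real (k*2+1) * (1/239) ^ (k*2+1)))"
    "(\<Sum>k<2*2. (-1)^k * (1 / real (k*2+1) * (1/239) ^ (k*2+1))) \<le> arctan (1/239)"
    by (rule arctan_series_bounds; simp)+
  ultimately show "3.14159265358979 < pi" "pi < 3.14159265358980"
    by (simp_all add: eval_nat_numeral)
qed

lemma ln2_lower: "0.69314718055994 < ln (2 :: real)"
  using ln_approx_bounds[of 2 14] by (simp add: eval_nat_numeral)

lemma ln_reciprocal_upper: "ln (1 / (40269750365 / 10 ^ 11)) \<le> (9095696102 / 10 ^ 10 :: real)"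
proof -
  \<comment> \<open>The factorization leaves arguments close to 1 besides ln 2, for which a few
    terms of the logarithm series suffice.\<close>
  have "ln (1 / (40269750365 / 10 ^ 11)) = ln (2 * (5 / 4) / (1006743759125 / 10 ^ 12) :: real)"
    by simp
  also have "\<dots> = ln 2 + ln (5 / 4) - ln (1006743759125 / 10 ^ 12)"
  proof -
    have "ln (a * b / x) = ln a + ln b - ln x" if "a > 0" "b > 0" "x > 0" for a b x :: real
      using that by (simp add: ln_div ln_mult)
    thus ?thesis by this simp_all
  qed
  finally have "ln (1 / (40269750365 / 10 ^ 11)) = ln 2 + ln (5 / 4) - ln (1006743759125 / 10 ^ 12 :: real)" .
  moreover have "ln (2 :: real) \<le> 0.6931471805600"
    using ln_approx_bounds[of 2 14] by (simp add: eval_nat_numeral)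
  moreover have "ln (5 / 4 :: real) \<le> 0.2231435513143"
    using ln_approx_bounds[of "5/4" 7] by (simp add: eval_nat_numeral)
  moreover have "ln (1006743759125 / 10 ^ 12 :: real) \<ge> 0.0067211216986"
    using ln_approx_bounds[of "1006743759125 / 10 ^ 12" 3] by (simp add: eval_nat_numeral)
  ultimately show ?thesis by simp
qed

lemma upper_constant: "2 * sqrt (ln (1 / (40269750365 / 10 ^ 11)) / pi) < 1.07615054545"
proof -
  have "1 / pi \<le> 1 / 3.14159265358979" using pi_bounds(1) by (intro divide_left_mono) auto
  hence "ln (1 / (40269750365 / 10 ^ 11)) * (1 / pi) \<le> (9095696102 / 10 ^ 10) * (1 / 3.14159265358979)"
    using ln_reciprocal_upper by (intro mult_mono) auto
  also have "\<dots> < (1.07615054545 / 2) ^ 2" by (simp add: power2_eq_square)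
  finally have "sqrt (ln (1 / (40269750365 / 10 ^ 11)) / pi) < 1.07615054545 / 2"
    by (intro real_less_lsqrt) simp_all
  thus ?thesis by simp
qed

lemma lower_constant: "1.05912614335 < 2 * sqrt ((1 + 4 * (6776042339987 / 100000000000000)) * ln 2 / pi)"
proof -
  have "(1.05912614335 / 2) ^ 2 < (1 + 4 * (6776042339987 / 100000000000000)) * 0.69314718055994 * (1 / 3.14159265358980 :: real)"
    by (simp add: power2_eq_square)
  also have "\<dots> \<le> (1 + 4 * (6776042339987 / 100000000000000)) * ln 2 * (1 / pi)"
    using ln2_lower pi_bounds(2) by (intro mult_mono divide_left_mono) (auto simp: less_imp_le)
  finally have "1.05912614335 / 2 < sqrt ((1 + 4 * (6776042339987 / 100000000000000)) * ln 2 / pi)"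
    by (intro real_less_rsqrt) simp
  thus ?thesis by simp
qed

theorem theorem1:
  shows "\<exists>c\<^sub>1 c\<^sub>2 :: real.
    \<bar>c\<^sub>1 - 1.0591261434\<bar> \<le> 5 / 10 ^ 11 \<and> \<bar>c\<^sub>2 - 1.0761505454\<bar> \<le> 5 / 10 ^ 11 \<and>
    (\<exists>\<epsilon>\<^sub>1 \<epsilon>\<^sub>2 :: nat \<Rightarrow> real. \<epsilon>\<^sub>1 \<longlonglongrightarrow> 0 \<and> \<epsilon>\<^sub>2 \<longlonglongrightarrow> 0 \<and>
      (\<forall>\<^sub>F n in sequentially.
        c\<^sub>1 * (real n / sqrt (ln (real n))) * (1 + \<epsilon>\<^sub>1 n)
          \<le> measure_pmf.expectation (random_tree n) (\<lambda>t. real (num_fringe_classes t)) \<and>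
        measure_pmf.expectation (random_tree n) (\<lambda>t. real (num_fringe_classes t))
          \<le> c\<^sub>2 * (real n / sqrt (ln (real n))) * (1 + \<epsilon>\<^sub>2 n))) \<and>
    (\<forall>\<eta>>0. (\<lambda>n. measure_pmf.prob (random_tree n)
        {t. (c\<^sub>1 - \<eta>) * (real n / sqrt (ln (real n))) \<le> real (num_fringe_classes t) \<and>
            real (num_fringe_classes t) \<le> (c\<^sub>2 + \<eta>) * (real n / sqrt (ln (real n)))})
      \<longlonglongrightarrow> 1)"
proof -
  \<comment> \<open>The optimal constants of the method are \<open>1.05912614335853\<dots>\<close> and \<open>1.07615054536853\<dots>\<close>.\<close>
  define c\<^sub>1 c\<^sub>2 :: real where "c\<^sub>1 = 1.05912614335" and "c\<^sub>2 = 1.07615054545"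
  define \<nu> :: real where "\<nu> = 4 * (6776042339987 / 100000000000000)"
  have upper: "\<forall>\<^sub>F n in sequentially. tree_E n (\<lambda>t. real (num_fringe_classes t)) \<le> c\<^sub>2 * scale n"
    "(\<lambda>n. tree_P n {t. real (num_fringe_classes t) \<le> c\<^sub>2 * scale n}) \<longlonglongrightarrow> 1"
    unfolding c\<^sub>2_def
    by (rule upper_bound[OF _ _ iso_sum_classes_le_1 upper_constant]; simp)+
  \<comment> \<open>The room between \<open>c\<^sub>1\<close> and \<open>c\<close> absorbs the
    exceptional probability when the lower bound is passed to the mean.\<close>
  obtain c where c: "c\<^sub>1 < c" "c < 2 * sqrt ((1 + \<nu>) * ln 2 / pi)"
    using dense lower_constant unfolding c\<^sub>1_def \<nu>_def by blast
  obtain d where "6776042339987 / 100000000000000 < iso_sum 1 (1 / 16) d"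
    using iso_sum_one_large by blast
  hence \<nu>: "0 \<le> \<nu>" "\<nu> < 4 * iso_sum 1 (1 / 16) d" by (simp_all add: \<nu>_def)
  have lower: "(\<lambda>n. tree_P n {t. c * scale n \<le> real (num_fringe_classes t)}) \<longlonglongrightarrow> 1"
    by (rule lower_bound[OF \<nu> c(2)])
  have c1: "c\<^sub>1 > 0" by (simp add: c\<^sub>1_def)
  have scale_pos: "\<forall>\<^sub>F n::nat in sequentially. scale n > 0" by real_asymp
  \<comment> \<open>The probability of reaching \<open>c * scale n\<close> eventually exceeds this
    ratio, and Markov's inequality turns that into a mean of at least
    \<open>c\<^sub>1 * scale n\<close>.\<close>
  have "c\<^sub>1 / c < 1" using c c1 by simp
  from order_tendstoD(1)[OF lower this] scale_pos eventually_ge_at_top[of 1]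
  have "\<forall>\<^sub>F n in sequentially. c\<^sub>1 * scale n \<le> tree_E n (\<lambda>t. real (num_fringe_classes t))"
  proof eventually_elim
    case (elim n)
    have pos: "c * scale n > 0" using c c1 elim by (intro mult_pos_pos) auto
    have "c\<^sub>1 * scale n = c\<^sub>1 / c * (c * scale n)" using c c1 by simp
    also have "\<dots> \<le> tree_P n {t. c * scale n \<le> real (num_fringe_classes t)} * (c * scale n)"
      using elim pos by (intro mult_right_mono) auto
    also have "\<dots> \<le> tree_E n (\<lambda>t. real (num_fringe_classes t))"
      using tree_P_Markov[OF elim(3), of "\<lambda>t. real (num_fringe_classes t)", OF _ pos] pos
      by (simp only: pos_le_divide_eq of_nat_0_le_iff)
    finally show ?case .
  qed
  with upper(1) have expectation: "\<forall>\<^sub>F n in sequentially.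
      c\<^sub>1 * scale n * (1 + 0) \<le> tree_E n (\<lambda>t. real (num_fringe_classes t)) \<and>
      tree_E n (\<lambda>t. real (num_fringe_classes t)) \<le> c\<^sub>2 * scale n * (1 + 0)"
    by eventually_elim simp
  have whp: "(\<lambda>n. tree_P n {t. (c\<^sub>1 - \<eta>) * scale n \<le> real (num_fringe_classes t) \<and>
      real (num_fringe_classes t) \<le> (c\<^sub>2 + \<eta>) * scale n}) \<longlonglongrightarrow> 1" if \<eta>: "\<eta> > 0" for \<eta>
  proof (rule tree_P_tendsto_1)
    let ?L = "\<lambda>n. {t. c * scale n \<le> real (num_fringe_classes t)}"
    let ?U = "\<lambda>n. {t. real (num_fringe_classes t) \<le> c\<^sub>2 * scale n}"
    show "(\<lambda>n. (1 - tree_P n (?L n)) + (1 - tree_P n (?U n))) \<longlonglongrightarrow> 0"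
      using tendsto_add[OF tendsto_diff[OF tendsto_const[of 1] lower] tendsto_diff[OF tendsto_const[of 1] upper(2)]]
      by simp
    show "\<forall>\<^sub>F n in sequentially. tree_P n (- {t. (c\<^sub>1 - \<eta>) * scale n \<le> real (num_fringe_classes t) \<and>
      real (num_fringe_classes t) \<le> (c\<^sub>2 + \<eta>) * scale n}) \<le> (1 - tree_P n (?L n)) + (1 - tree_P n (?U n))"
      using scale_pos eventually_ge_at_top[of 1]
    proof eventually_elim
      case (elim n)
      have "(c\<^sub>1 - \<eta>) * scale n \<le> c * scale n" "c\<^sub>2 * scale n \<le> (c\<^sub>2 + \<eta>) * scale n"
        using elim \<eta> c by (intro mult_right_mono; simp)+
      hence "tree_P n (- {t. (c\<^sub>1 - \<eta>) * scale n \<le> real (num_fringe_classes t) \<and>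
          real (num_fringe_classes t) \<le> (c\<^sub>2 + \<eta>) * scale n}) \<le> tree_P n (- ?L n \<union> - ?U n)"
        by (intro tree_P_mono elim) (auto simp del: times_divide_eq_right)
      also have "\<dots> \<le> tree_P n (- ?L n) + tree_P n (- ?U n)"
        by (rule measure_Un_le) auto
      also have "\<dots> = (1 - tree_P n (?L n)) + (1 - tree_P n (?U n))"
        using measure_pmf.prob_compl[of "?L n" "random_tree n"]
          measure_pmf.prob_compl[of "?U n" "random_tree n"]
        by (simp add: Compl_eq_Diff_UNIV)
      finally show ?case .
    qed
  qed
  have "\<bar>c\<^sub>1 - 1.0591261434\<bar> \<le> 5 / 10 ^ 11" "\<bar>c\<^sub>2 - 1.0761505454\<bar> \<le> 5 / 10 ^ 11"
    by (simp_all add: c\<^sub>1_def c\<^sub>2_def)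
  moreover have "\<exists>\<epsilon>\<^sub>1 \<epsilon>\<^sub>2 :: nat \<Rightarrow> real. \<epsilon>\<^sub>1 \<longlonglongrightarrow> 0 \<and> \<epsilon>\<^sub>2 \<longlonglongrightarrow> 0 \<and>
      (\<forall>\<^sub>F n in sequentially.
        c\<^sub>1 * scale n * (1 + \<epsilon>\<^sub>1 n) \<le> tree_E n (\<lambda>t. real (num_fringe_classes t)) \<and>
        tree_E n (\<lambda>t. real (num_fringe_classes t)) \<le> c\<^sub>2 * scale n * (1 + \<epsilon>\<^sub>2 n))"
    using expectation by (intro exI[of _ "\<lambda>_. 0"]) simp
  ultimately show ?thesis using whp by blast
qed

end
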